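(* Let $n\in\mathbb{N}$ (so $n\ge 1$), let $$\psi(t):=\frac{2\sqrt{n}}{n+1}\bigl(t(n+1-t)\bigr)^{1/2}+\left|1-\frac{2t}{n+1}\right|,\quad 0\le t\le n+1,\qquad a_n:=\left\lfloor\frac{n+1}{2}-\frac{\sqrt{n+1}}{2}\right\rfloor .$$ Then $$\theta_n(B_n)=\max\{\psi(a_n),\psi(a_n+1)\}.$$ Moreover, an interpolation projector $P:C(B_n)\to\Pi_1(\mathbb{R}^n)$ with nodes in $B_n$ satisfies $\|P\|_{B_n}=\theta_n(B_n)$ if and only if its interpolation nodes coincide with the vertices of a regular simplex inscribed into the boundary sphere of $B_n$.
   Context: $B_n=\{x\in\mathbb{R}^n:\|x\|\le 1\}$ is the closed Euclidean unit ball, where $\|\cdot\|$ is the Euclidean norm. $C(B_n)$ is the space of continuous functions $f:B_n\to\mathbb{R}$ with the uniform norm $\|f\|_{C(B_n)}=\max_{x\in B_n}|f(x)|$. $\Pi_1(\mathbb{R}^n)$ is the set of real polynomials in $n$ variables of degree $\le 1$ (i.e. affine functions on $\mathbb{R}^n$). Let $S\subset B_n$ be a nondegenerate $n$-dimensional simplex with vertices $x^{(1)},\dots,x^{(n+1)}$. The interpolation projector $P:C(B_n)\to\Pi_1(\mathbb{R}^n)$ with nodes $x^{(1)},\dots,x^{(n+1)}$ is the linear operator defined by $Pf\in\Pi_1(\mathbb{R}^n)$ and $Pf(x^{(j)})=f(x^{(j)})$ for $1\le j\le n+1$. Equivalently, $Pf(x)=\sum_{j=1}^{n+1}f(x^{(j)})\lambda_j(x)$,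 where $\lambda_j\in\Pi_1(\mathbb{R}^n)$ are determined by $\lambda_j(x^{(k)})=\delta_j^k$ (the barycentric coordinates with respect to $S$). $\|P\|_{B_n}$ denotes the norm of $P$ as an operator from $C(B_n)$ to $C(B_n)$ (with $Pf$ restricted to $B_n$); it equals $\max_{x\in B_n}\sum_{j=1}^{n+1}|\lambda_j(x)|$. $\theta_n(B_n)$ denotes the minimal value of $\|P\|_{B_n}$ over all interpolation projectors $P:C(B_n)\to\Pi_1(\mathbb{R}^n)$ whose nodes belong to $B_n$ and are the vertices of a nondegenerate simplex. *)

theory Defs
  imports "HOL-Analysis.Analysis"
begin

text \<open>
  The ambient space is \<open>real^'n\<close>, so that \<open>n = CARD('n) \<ge> 1\<close>, and \<open>B\<^sub>n\<close> is \<open>cball 0 1\<close>.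
  Elements of \<open>C(B\<^sub>n)\<close> are represented by functions on the whole space that are continuous on
  \<open>B\<^sub>n\<close>; their values outside \<open>B\<^sub>n\<close> enter none of the notions below.
\<close>

definition C_ball :: "(real^'n \<Rightarrow> real) set" where
  "C_ball = {f. continuous_on (cball 0 1) f}"

definition ball_norm :: "(real^'n \<Rightarrow> real) \<Rightarrow> real" where
  "ball_norm f = (SUP x\<in>cball 0 1. \<bar>f x\<bar>)"

definition Pi1 :: "(real^'n \<Rightarrow> real) set" where
  "Pi1 = {p. \<exists>a c. p = (\<lambda>x. a \<bullet> x + c)}"

definition nondegenerate_simplex_vertices :: "(real^'n) set \<Rightarrow> bool" where
  "nondegenerate_simplex_vertices V \<longleftrightarrow> card V = CARD('n) + 1 \<and> \<not> affine_dependent V"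

definition regular_simplex_vertices :: "(real^'n) set \<Rightarrow> bool" where
  "regular_simplex_vertices V \<longleftrightarrow>
     nondegenerate_simplex_vertices V \<and>
     (\<exists>d. \<forall>u\<in>V. \<forall>v\<in>V. u \<noteq> v \<longrightarrow> dist u v = d)"

text \<open>
  Nodes are families \<open>x 1, \<dots>, x (n+1)\<close>; the values of \<open>x\<close> at other indices are irrelevant.
  Since the image has \<open>n + 1\<close> elements, the nodes are pairwise distinct.
\<close>

definition nodes :: "(nat \<Rightarrow> real^'n) \<Rightarrow> (real^'n) set" where
  "nodes x = x ` {1..CARD('n) + 1}"

definition admissible_nodes :: "(nat \<Rightarrow> real^'n) \<Rightarrow> bool" where
  "admissible_nodes x \<longleftrightarrow> nodes x \<subseteq> cball 0 1 \<and> nondegenerate_simplex_vertices (nodes x)"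

definition linear_on_C_ball :: "((real^'n \<Rightarrow> real) \<Rightarrow> (real^'n \<Rightarrow> real)) \<Rightarrow> bool" where
  "linear_on_C_ball P \<longleftrightarrow>
     (\<forall>f\<in>C_ball. \<forall>g\<in>C_ball. P (\<lambda>y. f y + g y) = (\<lambda>y. P f y + P g y)) \<and>
     (\<forall>c. \<forall>f\<in>C_ball. P (\<lambda>y. c * f y) = (\<lambda>y. c * P f y))"

definition interpolation_projector ::
    "(nat \<Rightarrow> real^'n) \<Rightarrow> ((real^'n \<Rightarrow> real) \<Rightarrow> (real^'n \<Rightarrow> real)) \<Rightarrow> bool" where
  "interpolation_projector x P \<longleftrightarrow>
     admissible_nodes x \<and> linear_on_C_ball P \<and>
     (\<forall>f\<in>C_ball. P f \<in> Pi1 \<and> (\<forall>j\<in>{1..CARD('n) + 1}. P f (x j) = f (x j)))"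

definition projector_norm :: "((real^'n \<Rightarrow> real) \<Rightarrow> (real^'n \<Rightarrow> real)) \<Rightarrow> real" where
  "projector_norm P = (SUP f\<in>{f \<in> C_ball. ball_norm f \<le> 1}. ball_norm (P f))"

text \<open>
  The minimal value is a minimum and not merely an infimum: \<open>LEAST\<close> on the reals is determined
  only when the least value is attained.
\<close>

definition theta :: "'n::finite itself \<Rightarrow> real" where
  "theta _ = (LEAST r. \<exists>(x :: nat \<Rightarrow> real^'n) P. interpolation_projector x P \<and> r = projector_norm P)"

definition psi :: "nat \<Rightarrow> real \<Rightarrow> real" where
  "psi n t = 2 * sqrt (real n) / (real n + 1) * sqrt (t * (real n + 1 - t))
             + \<bar>1 - 2 * t / (real n + 1)\<bar>"

definition a_opt :: "nat \<Rightarrow> int" where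
  "a_opt n = \<lfloor>(real n + 1) / 2 - sqrt (real n + 1) / 2\<rfloor>"

end

theory Submission
  imports Defs
begin

text \<open>
  Write the barycentric coordinates as \<open>l i \<bullet> y + c i\<close>. Evaluating \<open>P\<close> on functions that take
  the value \<open>-1\<close> at the nodes of a subset \<open>J\<close> and \<open>1\<close> at the others gives
  \<open>\<bar>1 - 2 * sum c J\<bar> + 2 * norm (sum l J) \<le> projector_norm P\<close>. Pairing \<open>sum l J\<close> with the sum
  over \<open>J\<close> of the centred nodes gives the constant \<open>k (n + 1 - k) / (n + 1)\<close> for every
  \<open>J\<close> with \<open>k\<close> elements, while the squared norms of these sums average to at most
  \<open>k (n + 1 - k) / n\<close>. Cauchy-Schwarz and convexity of \<open>z powr (-1/2)\<close> then show that the
  average over \<open>J\<close> of the left-hand sides is at least \<open>psi n k\<close>. In the case of equality the nodes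
  are unit vectors with sum \<open>0\<close>, and \<open>sum l J\<close> is parallel to \<open>sum x J\<close> for each \<open>J\<close>; comparing
  sets \<open>J\<close> that differ by one exchange shows that all products of distinct nodes agree.
\<close>

section \<open>Sums over subsets of fixed size\<close>

text \<open>Deleting \<open>i\<close> is a bijection onto the subsets of
  \<open>I - insert i A\<close> of size \<open>k - 1\<close>. With \<open>A\<close> empty this
  counts the sets through a point, with \<open>A\<close> a singleton the sets that separate an
  ordered pair.\<close>

lemma card_subsets_containing_avoiding:
  assumes "finite I" "i \<in> I" "i \<notin> A" "k \<ge> 1"
  shows "card {J. J \<subseteq> I \<and> card J = k \<and> i \<in> J \<and> J \<inter> A = {}} = card (I - insert i A) choose (k - 1)"
proof -
  let ?G = "{J. J \<subseteq> I - insert i A \<and> card J = k - 1}"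
  have "{J. J \<subseteq> I \<and> card J = k \<and> i \<in> J \<and> J \<inter> A = {}} = insert i ` ?G" (is "?F = _")
  proof
    show "?F \<subseteq> insert i ` ?G"
    proof
      fix J assume J: "J \<in> ?F"
      then have "finite J" using assms(1) finite_subset by auto
      with J have "J - {i} \<in> ?G" "J = insert i (J - {i})" by auto
      then show "J \<in> insert i ` ?G" by blast
    qed
    show "insert i ` ?G \<subseteq> ?F"
    proof clarify
      fix J assume J: "J \<subseteq> I - insert i A" "card J = k - 1"
      then have "finite J" using assms(1) finite_subset by blast
      then show "insert i J \<subseteq> I \<and> card (insert i J) = k \<and> i \<in> insert i J \<and> insert i J \<inter> A = {}"
        using J assms by (auto simp: card_insert_if)
    qed
  qed
  moreover have "inj_on (insert i) ?G"
  proof (rule inj_onI)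
    fix J J' assume "J \<in> ?G" "J' \<in> ?G" and eq: "insert i J = insert i J'"
    then have "i \<notin> J" "i \<notin> J'" by auto
    with eq show "J = J'" by (simp add: insert_ident)
  qed
  ultimately have "card ?F = card ?G"
    by (simp add: card_image)
  also have "\<dots> = card (I - insert i A) choose (k - 1)"
    using assms(1) by (simp add: n_subsets)
  finally show ?thesis .
qed

lemma sum_over_k_subsets:
  fixes z :: "'b \<Rightarrow> real"
  assumes "finite I" "k \<ge> 1"
  shows "(\<Sum>J | J \<subseteq> I \<and> card J = k. sum z J) = real ((card I - 1) choose (k - 1)) * sum z I"
proof -
  have "(\<Sum>J | J \<subseteq> I \<and> card J = k. sum z J)
      = (\<Sum>J | J \<subseteq> I \<and> card J = k. \<Sum>i | i \<in> I \<and> i \<in> J. z i)"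
    by (intro sum.cong refl) auto
  also have "\<dots> = (\<Sum>i\<in>I. \<Sum>J | J \<in> {J. J \<subseteq> I \<and> card J = k} \<and> i \<in> J. z i)"
    using assms by (intro sum.swap_restrict) auto
  also have "\<dots> = (\<Sum>i\<in>I. real ((card I - 1) choose (k - 1)) * z i)"
  proof (rule sum.cong[OF refl])
    fix i assume i: "i \<in> I"
    have "{J \<in> {J. J \<subseteq> I \<and> card J = k}. i \<in> J} = {J. J \<subseteq> I \<and> card J = k \<and> i \<in> J \<and> J \<inter> {} = {}}"
      by auto
    then have "card {J \<in> {J. J \<subseteq> I \<and> card J = k}. i \<in> J} = (card I - 1) choose (k - 1)"
      using card_subsets_containing_avoiding[of I i "{}" k] i assms by simp
    then show "(\<Sum>J | J \<in> {J. J \<subseteq> I \<and> card J = k} \<and> i \<in> J. z i) = real ((card I - 1) choose (k - 1)) * z i"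
      by simp
  qed
  finally show ?thesis by (simp add: sum_distrib_left)
qed

text \<open>As the total is \<open>0\<close>, the sum over \<open>J\<close> is minus the sum over
  its complement, so each squared norm is minus the sum of the products over pairs that
  \<open>J\<close> separates. Every ordered pair of distinct indices is separated by the same number
  of sets.\<close>

lemma sum_norm_sq_over_k_subsets:
  fixes w :: "'b \<Rightarrow> 'a::real_inner"
  assumes "finite I" "k \<ge> 1" "sum w I = 0"
  shows "(\<Sum>J | J \<subseteq> I \<and> card J = k. (norm (sum w J))\<^sup>2)
       = real ((card I - 2) choose (k - 1)) * (\<Sum>i\<in>I. (norm (w i))\<^sup>2)"
proof -
  let ?F = "{J. J \<subseteq> I \<and> card J = k}"
  let ?g = "\<lambda>J (i, j). if i \<in> J \<and> j \<notin> J then w i \<bullet> w j else 0"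
  have fin: "finite ?F" using assms by auto
  have "(norm (sum w J))\<^sup>2 = - (\<Sum>p\<in>I \<times> I. ?g J p)" if "J \<in> ?F" for J
  proof -
    have J: "J \<subseteq> I" using that by auto
    have "sum w J = - sum w (I - J)"
      using assms J by (simp add: sum_diff)
    then have "(norm (sum w J))\<^sup>2 = - (sum w J \<bullet> sum w (I - J))"
      by (metis inner_minus_right power2_norm_eq_inner)
    also have "sum w J \<bullet> sum w (I - J) = (\<Sum>i\<in>J. \<Sum>j\<in>I - J. w i \<bullet> w j)"
      unfolding inner_sum_left inner_sum_right by (rule sum.swap)
    also have "\<dots> = (\<Sum>(i, j)\<in>J \<times> (I - J). w i \<bullet> w j)"
      by (simp add: sum.cartesian_product)
    also have "\<dots> = (\<Sum>p\<in>I \<times> I. ?g J p)"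
      using J assms(1) by (intro sum.mono_neutral_cong_left) (auto split: if_splits)
    finally show ?thesis .
  qed
  then have "(\<Sum>J\<in>?F. (norm (sum w J))\<^sup>2) = - (\<Sum>J\<in>?F. \<Sum>p\<in>I \<times> I. ?g J p)"
    by (simp add: sum_negf)
  also have "(\<Sum>J\<in>?F. \<Sum>p\<in>I \<times> I. ?g J p) = (\<Sum>p\<in>I \<times> I. \<Sum>J\<in>?F. ?g J p)"
    by (rule sum.swap)
  also have "\<dots> = (\<Sum>p\<in>I \<times> I. real ((card I - 2) choose (k - 1)) *
                    (case p of (i, j) \<Rightarrow> if i = j then 0 else w i \<bullet> w j))"
  proof (rule sum.cong[OF refl])
    fix p assume "p \<in> I \<times> I"
    then obtain i j where p: "p = (i, j)" and ij: "i \<in> I" "j \<in> I" by auto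
    have "(\<Sum>J\<in>?F. ?g J (i, j)) = (\<Sum>J | J \<in> ?F \<and> i \<in> J \<and> j \<notin> J. w i \<bullet> w j)"
      unfolding prod.case by (subst sum.inter_filter[OF fin]) auto
    also have "\<dots> = real (card {J. J \<in> ?F \<and> i \<in> J \<and> j \<notin> J}) * (w i \<bullet> w j)"
      by simp
    also have "\<dots> = real ((card I - 2) choose (k - 1)) * (if i = j then 0 else w i \<bullet> w j)"
    proof (cases "i = j")
      case False
      have "{J. J \<in> ?F \<and> i \<in> J \<and> j \<notin> J} = {J. J \<subseteq> I \<and> card J = k \<and> i \<in> J \<and> J \<inter> {j} = {}}"
        by auto
      moreover have "card (I - {i, j}) = card I - 2"
        using False ij assms(1) by (simp add: card_Diff_subset)
      ultimately show ?thesis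
        using card_subsets_containing_avoiding[of I i "{j}" k] False ij assms by simp
    qed simp
    finally show "(\<Sum>J\<in>?F. ?g J p) = real ((card I - 2) choose (k - 1)) *
        (case p of (i, j) \<Rightarrow> if i = j then 0 else w i \<bullet> w j)"
      unfolding p prod.case .
  qed
  also have "\<dots> = real ((card I - 2) choose (k - 1)) *
       (\<Sum>i\<in>I. \<Sum>j\<in>I. if i = j then 0 else w i \<bullet> w j)"
    by (simp add: sum_distrib_left[symmetric] sum.cartesian_product)
  \<comment> \<open>Each full row of the Gram matrix sums to \<open>0\<close>, so without its
    diagonal entry it gives minus that entry.\<close>
  also have "(\<Sum>i\<in>I. \<Sum>j\<in>I. if i = j then 0 else w i \<bullet> w j) = (\<Sum>i\<in>I. - (norm (w i))\<^sup>2)"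
  proof (rule sum.cong[OF refl])
    fix i assume i: "i \<in> I"
    have "(\<Sum>j\<in>I. if i = j then 0 else w i \<bullet> w j) = (\<Sum>j\<in>I. w i \<bullet> w j - (if i = j then w i \<bullet> w j else 0))"
      by (intro sum.cong) auto
    also have "\<dots> = w i \<bullet> sum w I - w i \<bullet> w i"
      using i assms(1) by (simp add: sum_subtractf inner_sum_right)
    finally show "(\<Sum>j\<in>I. if i = j then 0 else w i \<bullet> w j) = - (norm (w i))\<^sup>2"
      using assms by (simp add: power2_norm_eq_inner)
  qed
  finally show ?thesis by (simp add: sum_negf)
qed

text \<open>Among the \<open>k\<close>-subsets of \<open>n + 1\<close> points, these are the
  proportions that contain a given point and that separate a given ordered pair of distinct
  points.\<close>

lemma binomial_ratios:
  assumes "1 \<le> k" "k \<le> n"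
  shows "real (n choose (k - 1)) = real k / (real n + 1) * real ((n + 1) choose k)"
    and "real ((n - 1) choose (k - 1))
       = real k * (real n + 1 - real k) / ((real n + 1) * real n) * real ((n + 1) choose k)"
proof -
  have "k * ((n + 1) choose k) = (n + 1) * (n choose (k - 1))"
    using times_binomial_minus1_eq[of k "n + 1"] assms by simp
  then have "real k * real ((n + 1) choose k) = real (n + 1) * real (n choose (k - 1))"
    by (metis of_nat_mult)
  then show 1: "real (n choose (k - 1)) = real k / (real n + 1) * real ((n + 1) choose k)"
    by (simp add: field_simps)
  have "(n - (k - 1)) * (n choose (k - 1)) = n * ((n - 1) choose (k - 1))"
    by (rule binomial_absorb_comp)
  then have "real (n - (k - 1)) * real (n choose (k - 1)) = real n * real ((n - 1) choose (k - 1))"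
    by (metis of_nat_mult)
  moreover have "real (n - (k - 1)) = real n + 1 - real k"
    using assms by (simp add: of_nat_diff)
  ultimately have "real ((n - 1) choose (k - 1)) = (real n + 1 - real k) * real (n choose (k - 1)) / real n"
    using assms by (simp add: field_simps)
  then show "real ((n - 1) choose (k - 1))
       = real k * (real n + 1 - real k) / ((real n + 1) * real n) * real ((n + 1) choose k)"
    unfolding 1 by simp
qed

text \<open>The tangent of \<open>z \<mapsto> z powr (-1/2)\<close> at \<open>z = R\<^sup>2\<close>, evaluated at \<open>z = r\<^sup>2\<close>.\<close>

lemma inverse_ge_tangent:
  fixes r R :: real
  assumes "r > 0" "R > 0"
  shows "(3 * R\<^sup>2 - r\<^sup>2) / (2 * R ^ 3) \<le> 1 / r"
    and "(3 * R\<^sup>2 - r\<^sup>2) / (2 * R ^ 3) = 1 / r \<Longrightarrow> r = R"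
proof -
  \<comment> \<open>Tangency appears as the double root at \<open>r = R\<close> of the numerator
    \<open>2 * R ^ 3 - 3 * R\<^sup>2 * r + r ^ 3\<close>.\<close>
  have eq: "1 / r - (3 * R\<^sup>2 - r\<^sup>2) / (2 * R ^ 3) = (r - R)\<^sup>2 * (r + 2 * R) / (2 * R ^ 3 * r)"
    using assms by (simp add: field_simps power2_eq_square power3_eq_cube)
  have "(r - R)\<^sup>2 * (r + 2 * R) / (2 * R ^ 3 * r) \<ge> 0"
    using assms by simp
  with eq show "(3 * R\<^sup>2 - r\<^sup>2) / (2 * R ^ 3) \<le> 1 / r" by linarith
  assume "(3 * R\<^sup>2 - r\<^sup>2) / (2 * R ^ 3) = 1 / r"
  with eq have "(r - R)\<^sup>2 * (r + 2 * R) / (2 * R ^ 3 * r) = 0" by linarith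
  then show "r = R" using assms by simp
qed

section \<open>The averaging argument\<close>

text \<open>The forms \<open>l i \<bullet> y + c i\<close> are the barycentric coordinates of the
  nodes \<open>x i\<close>; \<open>sum_c\<close> records that they add up to \<open>1\<close> at the
  origin.\<close>

locale barycentric =
  fixes I :: "'b set" and n :: nat and x l :: "'b \<Rightarrow> 'a::real_inner" and c :: "'b \<Rightarrow> real"
  assumes finite_I [simp]: "finite I"
    and card_I: "card I = n + 1"
    and n_pos: "n \<ge> 1"
    and norm_le_1: "i \<in> I \<Longrightarrow> norm (x i) \<le> 1"
    and dual: "i \<in> I \<Longrightarrow> j \<in> I \<Longrightarrow> l i \<bullet> x j + c i = (if i = j then 1 else 0)"
    and sum_c: "sum c I = 1"
begin

definition centred :: "'b \<Rightarrow> 'a" where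
  "centred i = x i - sum x I /\<^sub>R (real n + 1)"

lemma dual_sum:
  assumes "J \<subseteq> I" "j \<in> I"
  shows "sum l J \<bullet> x j = (if j \<in> J then 1 else 0) - sum c J"
proof -
  have "sum l J \<bullet> x j + sum c J = (\<Sum>i\<in>J. l i \<bullet> x j + c i)"
    by (simp add: inner_sum_left sum.distrib)
  also have "\<dots> = (\<Sum>i\<in>J. if i = j then 1 else 0)"
    using assms dual by (intro sum.cong) auto
  also have "\<dots> = (if j \<in> J then 1 else 0)"
    using assms finite_subset[OF assms(1)] by simp
  finally show ?thesis by linarith
qed

lemma inner_sum_nodes:
  assumes "J \<subseteq> I" "card J = k"
  shows "sum l J \<bullet> sum x J = real k * (1 - sum c J)"
proof -
  have "sum l J \<bullet> sum x J = (\<Sum>j\<in>J. 1 - sum c J)"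
    unfolding inner_sum_right
  proof (rule sum.cong[OF refl])
    fix j assume "j \<in> J"
    then show "sum l J \<bullet> x j = 1 - sum c J" using dual_sum[of J j] assms(1) by auto
  qed
  then show ?thesis using assms by simp
qed

lemma sum_centred:
  assumes "card J = k"
  shows "sum centred J = sum x J - (real k / (real n + 1)) *\<^sub>R sum x I"
  unfolding centred_def sum_subtractf using assms
  by (simp add: sum_constant_scaleR divide_inverse)

lemma sum_centred_I: "sum centred I = 0"
  by (subst sum_centred[OF card_I]) (simp add: add.commute[of 1])

text \<open>The unknown offset \<open>sum c J\<close> enters the pairings with
  \<open>sum x J\<close> and with the centroid equally, so centring cancels it and only
  \<open>k\<close> and \<open>n\<close> remain.\<close>

lemma inner_centred:
  assumes "J \<subseteq> I" "card J = k"
  shows "sum l J \<bullet> sum centred J = real k * (real n + 1 - real k) / (real n + 1)"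
proof -
  have "sum l J \<bullet> sum x I = (\<Sum>j\<in>I. (if j \<in> J then 1 else 0) - sum c J)"
    unfolding inner_sum_right using assms dual_sum by (intro sum.cong) auto
  also have "\<dots> = real k - (real n + 1) * sum c J"
    using assms by (simp add: sum_subtractf card_I sum.If_cases Int_absorb1 algebra_simps)
  finally have 2: "sum l J \<bullet> sum x I = real k - (real n + 1) * sum c J" .
  have "sum l J \<bullet> sum centred J
      = real k * (1 - sum c J) - real k / (real n + 1) * (real k - (real n + 1) * sum c J)"
    using 2 inner_sum_nodes[OF assms] assms by (simp add: sum_centred inner_diff_right)
  then show ?thesis by (simp add: field_simps)
qed

text \<open>The parallel axis identity: moving the origin to the centroid lowers the total squared
  norm by \<open>n + 1\<close> times the squared norm of the centroid.\<close>

lemma sum_norm_sq_centred: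
  "(\<Sum>i\<in>I. (norm (centred i))\<^sup>2)
     = (\<Sum>i\<in>I. (norm (x i))\<^sup>2) - (norm (sum x I))\<^sup>2 / (real n + 1)"
proof -
  define s where "s = sum x I /\<^sub>R (real n + 1)"
  have sI: "sum x I = (real n + 1) *\<^sub>R s" by (simp add: s_def)
  have "(\<Sum>i\<in>I. (norm (centred i))\<^sup>2) = (\<Sum>i\<in>I. (norm (x i))\<^sup>2 - 2 * (x i \<bullet> s) + s \<bullet> s)"
    unfolding centred_def s_def[symmetric]
    by (intro sum.cong refl)
       (simp add: power2_norm_eq_inner inner_diff_left inner_diff_right inner_commute)
  also have "\<dots> = (\<Sum>i\<in>I. (norm (x i))\<^sup>2) - 2 * (sum x I \<bullet> s) + (real n + 1) * (s \<bullet> s)"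
    by (simp add: sum.distrib sum_subtractf sum_distrib_left inner_sum_left card_I)
  also have "\<dots> = (\<Sum>i\<in>I. (norm (x i))\<^sup>2) - (norm (sum x I))\<^sup>2 / (real n + 1)"
    unfolding sI power2_norm_eq_inner by simp
  finally show ?thesis .
qed

lemma sum_norm_sq_centred_le: "(\<Sum>i\<in>I. (norm (centred i))\<^sup>2) \<le> real n + 1"
  and sum_norm_sq_centred_eqD:
    "(\<Sum>i\<in>I. (norm (centred i))\<^sup>2) = real n + 1 \<Longrightarrow> sum x I = 0 \<and> (\<forall>i\<in>I. norm (x i) = 1)"
proof -
  have sq: "(norm (x i))\<^sup>2 \<le> 1" if "i \<in> I" for i
    using norm_le_1[OF that] by (simp add: power_le_one)
  then have le: "(\<Sum>i\<in>I. (norm (x i))\<^sup>2) \<le> real n + 1"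
    using sum_bounded_above[of I "\<lambda>i. (norm (x i))\<^sup>2" 1] by (simp add: card_I)
  have nn: "(norm (sum x I))\<^sup>2 / (real n + 1) \<ge> 0" by simp
  show "(\<Sum>i\<in>I. (norm (centred i))\<^sup>2) \<le> real n + 1"
    unfolding sum_norm_sq_centred using le nn by linarith
  assume eq: "(\<Sum>i\<in>I. (norm (centred i))\<^sup>2) = real n + 1"
  then have "(norm (sum x I))\<^sup>2 / (real n + 1) = 0" and s: "(\<Sum>i\<in>I. (norm (x i))\<^sup>2) = real n + 1"
    unfolding sum_norm_sq_centred using le nn by linarith+
  then have "sum x I = 0" by (auto simp: add_eq_0_iff)
  moreover have "(\<Sum>i\<in>I. 1 - (norm (x i))\<^sup>2) = 0"
    using s by (simp add: sum_subtractf card_I)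
  then have "\<forall>i\<in>I. 1 - (norm (x i))\<^sup>2 = 0"
    using sq by (subst (asm) sum_nonneg_eq_0_iff) auto
  then have "\<forall>i\<in>I. norm (x i) = 1"
    by (simp add: abs_square_eq_1)
  ultimately show "sum x I = 0 \<and> (\<forall>i\<in>I. norm (x i) = 1)" by simp
qed

text \<open>In the application \<open>M\<close> is the norm of the projector. The range of
  \<open>k\<close> leaves out the empty and the full index set, for which the pairing of
  \<open>inner_centred\<close> is \<open>0\<close>.\<close>

context
  fixes k :: nat and M :: real
  assumes k: "1 \<le> k" "k \<le> n"
    and bound: "J \<subseteq> I \<Longrightarrow> card J = k \<Longrightarrow> \<bar>1 - 2 * sum c J\<bar> + 2 * norm (sum l J) \<le> M"
begin

text \<open>
  For the regular simplex inscribed in the unit sphere, every \<open>k\<close>-subset \<open>J\<close> has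
  \<open>sum l J \<bullet> sum x J = K\<close> and \<open>norm (sum x J) = R\<close>.
\<close>

definition K :: real where "K = real k * (real n + 1 - real k) / (real n + 1)"
definition R :: real where "R = sqrt (real k * (real n + 1 - real k) / real n)"
definition C :: real where "C = real ((n + 1) choose k)"
definition k_subsets :: "'b set set" where "k_subsets = {J. J \<subseteq> I \<and> card J = k}"
text \<open>The mean squared distance of the nodes from their centroid. It is at most
  \<open>1\<close>, with equality only for unit nodes whose centroid is the origin.\<close>

definition spread :: real where "spread = (\<Sum>i\<in>I. (norm (centred i))\<^sup>2) / (real n + 1)"
text \<open>Cauchy-Schwarz bounds \<open>norm (sum l J)\<close> below by
  \<open>K / norm (sum centred J)\<close>. This is its tangent minorant, affine in the squared norm,
  so that its sum over \<open>J\<close> can be computed exactly.\<close>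

definition tangent :: "'b set \<Rightarrow> real" where
  "tangent J = K * ((3 * R\<^sup>2 - (norm (sum centred J))\<^sup>2) / (2 * R ^ 3))"

lemma constants_pos: "K > 0" "R > 0" "C > 0" "R\<^sup>2 = real k * (real n + 1 - real k) / real n"
proof -
  have m: "real k * (real n + 1 - real k) > 0" using k by simp
  show "K > 0" unfolding K_def using m by (intro divide_pos_pos) auto
  have q: "real k * (real n + 1 - real k) / real n > 0" using m k by (intro divide_pos_pos) auto
  show "R > 0" unfolding R_def using q by simp
  show "R\<^sup>2 = real k * (real n + 1 - real k) / real n" unfolding R_def using q by (intro real_sqrt_pow2) simp
  show "C > 0" using k by (simp add: C_def)
qed

lemma card_k_subsets: "real (card k_subsets) = C"
  by (simp add: n_subsets card_I C_def k_subsets_def)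

text \<open>For \<open>spread = 1\<close> the mean of the squared norms is exactly
  \<open>R\<^sup>2\<close>, which is why the tangent is taken there.\<close>

lemma sum_norm_sq_k_subsets: "(\<Sum>J\<in>k_subsets. (norm (sum centred J))\<^sup>2) = C * R\<^sup>2 * spread"
proof -
  have "(\<Sum>J\<in>k_subsets. (norm (sum centred J))\<^sup>2) = real ((n - 1) choose (k - 1)) * (\<Sum>i\<in>I. (norm (centred i))\<^sup>2)"
    using sum_norm_sq_over_k_subsets[OF finite_I k(1) sum_centred_I] by (simp add: card_I k_subsets_def)
  then show ?thesis unfolding binomial_ratios(2)[OF k] constants_pos(4) C_def spread_def by (simp add: mult_ac)
qed

text \<open>Cauchy-Schwarz followed by the tangent inequality. Equality overall forces equality in
  both, and the second fixes \<open>norm (sum centred J)\<close>.\<close>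

lemma tangent_le:
  assumes "J \<in> k_subsets"
  shows "tangent J \<le> norm (sum l J)"
    and "tangent J = norm (sum l J) \<Longrightarrow> norm (sum centred J) = R \<and> norm (sum l J) = K / R"
proof -
  have K: "sum l J \<bullet> sum centred J = K" using inner_centred assms by (auto simp: k_subsets_def K_def)
  then have "sum centred J \<noteq> 0" using constants_pos by force
  then have r: "norm (sum centred J) > 0" by simp
  have "K \<le> norm (sum l J) * norm (sum centred J)"
    using norm_cauchy_schwarz[of "sum l J" "sum centred J"] K by simp
  then have 1: "K * (1 / norm (sum centred J)) \<le> norm (sum l J)"
    using r by (simp add: pos_divide_le_eq)
  have 2: "tangent J \<le> K * (1 / norm (sum centred J))"
    unfolding tangent_def using inverse_ge_tangent(1)[OF r constants_pos(2)] constants_pos(1) by (intro mult_left_mono) auto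
  from 1 2 show "tangent J \<le> norm (sum l J)" by linarith
  assume eq: "tangent J = norm (sum l J)"
  with 1 2 have e: "tangent J = K * (1 / norm (sum centred J))" "norm (sum l J) = K * (1 / norm (sum centred J))"
    by linarith+
  then have "(3 * R\<^sup>2 - (norm (sum centred J))\<^sup>2) / (2 * R ^ 3) = 1 / norm (sum centred J)"
    using constants_pos(1) unfolding tangent_def by (metis less_irrefl mult_left_cancel)
  then have "norm (sum centred J) = R"
    by (rule inverse_ge_tangent(2)[OF r constants_pos(2)])
  with e(2) show "norm (sum centred J) = R \<and> norm (sum l J) = K / R" by simp
qed

lemma sum_tangent: "2 * (\<Sum>J\<in>k_subsets. tangent J) = 2 * (C * (K / R)) + C * (K / R) * (1 - spread)"
proof -
  have "(\<Sum>J\<in>k_subsets. tangent J) = K / (2 * R ^ 3) * (3 * R\<^sup>2 * C - (\<Sum>J\<in>k_subsets. (norm (sum centred J))\<^sup>2))"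
    unfolding tangent_def
    by (simp add: sum_distrib_left[symmetric] sum_divide_distrib[symmetric] sum_subtractf card_k_subsets mult.commute)
  also have "2 * \<dots> = 2 * (C * (K / R)) + C * (K / R) * (1 - spread)"
    unfolding sum_norm_sq_k_subsets using constants_pos(2) by (simp add: field_simps power2_eq_square power3_eq_cube)
  finally show ?thesis .
qed

text \<open>Identifies \<open>psi n k\<close> with the left-hand side of \<open>bound\<close> when
  \<open>sum c J\<close> is its mean \<open>k / (n + 1)\<close> and \<open>norm (sum l J)\<close> is
  \<open>K / R\<close>, as for the inscribed regular simplex.\<close>

lemma psi_eq: "psi n (real k) = \<bar>1 - 2 * (real k / (real n + 1))\<bar> + 2 * (K / R)"
proof -
  define m where "m = real k * (real n + 1 - real k)"
  have m: "m > 0" using k by (simp add: m_def)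
  have "K / R = m / sqrt m * sqrt (real n) / (real n + 1)"
    unfolding K_def R_def m_def[symmetric] by (simp add: real_sqrt_divide)
  also have "m / sqrt m = sqrt m" using m by (simp add: real_div_sqrt)
  finally show ?thesis by (simp add: psi_def m_def)
qed

lemma sum_abs_offset: "C * \<bar>1 - 2 * (real k / (real n + 1))\<bar> \<le> (\<Sum>J\<in>k_subsets. \<bar>1 - 2 * sum c J\<bar>)"
proof -
  have "(\<Sum>J\<in>k_subsets. 1 - 2 * sum c J) = C - 2 * (\<Sum>J\<in>k_subsets. sum c J)"
    by (simp add: sum_subtractf sum_distrib_left card_k_subsets)
  also have "(\<Sum>J\<in>k_subsets. sum c J) = real k / (real n + 1) * C"
    using sum_over_k_subsets[OF finite_I k(1), of c] binomial_ratios(1)[OF k]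
    by (simp add: card_I sum_c k_subsets_def C_def)
  finally have "(\<Sum>J\<in>k_subsets. 1 - 2 * sum c J) = C * (1 - 2 * (real k / (real n + 1)))"
    by (simp add: algebra_simps)
  then have "C * \<bar>1 - 2 * (real k / (real n + 1))\<bar> = \<bar>\<Sum>J\<in>k_subsets. 1 - 2 * sum c J\<bar>"
    using constants_pos(3) by (simp add: abs_mult)
  also have "\<dots> \<le> (\<Sum>J\<in>k_subsets. \<bar>1 - 2 * sum c J\<bar>)" by (rule sum_abs)
  finally show ?thesis .
qed

text \<open>\<open>bound\<close> summed over all \<open>k\<close>-subsets. The deficit from
  \<open>spread\<close> and the deficits from the tangents are kept as separate non-negative terms
  for use in the case of equality.\<close>

lemma averaged_bound:
  "C * psi n (real k) + C * (K / R) * (1 - spread) + 2 * (\<Sum>J\<in>k_subsets. norm (sum l J) - tangent J) \<le> C * M"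
proof -
  have "(\<Sum>J\<in>k_subsets. \<bar>1 - 2 * sum c J\<bar> + 2 * norm (sum l J)) \<le> C * M"
    using sum_bounded_above[of k_subsets "\<lambda>J. \<bar>1 - 2 * sum c J\<bar> + 2 * norm (sum l J)" M] bound card_k_subsets
    by (auto simp: k_subsets_def)
  then have 1: "(\<Sum>J\<in>k_subsets. \<bar>1 - 2 * sum c J\<bar>) + 2 * (\<Sum>J\<in>k_subsets. norm (sum l J)) \<le> C * M"
    by (simp add: sum.distrib sum_distrib_left)
  have 2: "(\<Sum>J\<in>k_subsets. norm (sum l J) - tangent J) = (\<Sum>J\<in>k_subsets. norm (sum l J)) - (\<Sum>J\<in>k_subsets. tangent J)"
    by (rule sum_subtractf)
  have 3: "C * psi n (real k) = C * \<bar>1 - 2 * (real k / (real n + 1))\<bar> + 2 * (C * (K / R))"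
    unfolding psi_eq by (simp add: distrib_left)
  define X Y where "X = C * (K / R) * (1 - spread)" and "Y = C * \<bar>1 - 2 * (real k / (real n + 1))\<bar>"
  show ?thesis
    using 1 2 3 sum_abs_offset sum_tangent unfolding X_def[symmetric] Y_def[symmetric] by linarith
qed

lemma spread_term_nonneg: "C * (K / R) * (1 - spread) \<ge> 0"
proof -
  have "spread \<le> 1" using sum_norm_sq_centred_le by (simp add: spread_def)
  then show ?thesis using constants_pos by (intro mult_nonneg_nonneg divide_nonneg_nonneg) auto
qed

lemma psi_le: "psi n (real k) \<le> M"
proof -
  have "(\<Sum>J\<in>k_subsets. norm (sum l J) - tangent J) \<ge> 0"
    using tangent_le(1) by (intro sum_nonneg) auto
  with averaged_bound spread_term_nonneg have "C * psi n (real k) \<le> C * M" by linarith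
  then show ?thesis using constants_pos(3) by simp
qed

section \<open>The case of equality\<close>

lemma psi_eqD:
  assumes M: "M = psi n (real k)"
  shows "sum x I = 0" "i \<in> I \<Longrightarrow> norm (x i) = 1"
    and "J \<subseteq> I \<Longrightarrow> card J = k \<Longrightarrow> j \<in> I - J \<Longrightarrow> sum x J \<bullet> x j = - real k / real n"
proof -
  have nn: "\<And>J. J \<in> k_subsets \<Longrightarrow> norm (sum l J) - tangent J \<ge> 0" using tangent_le(1) by force
  then have "(\<Sum>J\<in>k_subsets. norm (sum l J) - tangent J) \<ge> 0" by (intro sum_nonneg) auto
  \<comment> \<open>With \<open>M = psi n k\<close> the two non-negative deficits have a sum of at
    most \<open>0\<close>, so each of them vanishes.\<close>
  with averaged_bound spread_term_nonneg have 0: "C * (K / R) * (1 - spread) = 0" "(\<Sum>J\<in>k_subsets. norm (sum l J) - tangent J) = 0"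
    unfolding M by linarith+
  have "spread = 1" using 0(1) constants_pos(1-3) by simp
  then have "(\<Sum>i\<in>I. (norm (centred i))\<^sup>2) = real n + 1"
    using of_nat_0_le_iff[of n, where 'a = real] by (simp add: spread_def divide_eq_1_iff)
  from sum_norm_sq_centred_eqD[OF this]
  show s: "sum x I = 0" and "i \<in> I \<Longrightarrow> norm (x i) = 1" by auto
  assume J: "J \<subseteq> I" "card J = k" and j: "j \<in> I - J"
  have J_mem: "J \<in> k_subsets" using J by (simp add: k_subsets_def)
  have "finite k_subsets" by (simp add: k_subsets_def)
  then have "norm (sum l J) - tangent J = 0"
    using 0(2) nn J_mem sum_nonneg_eq_0_iff[of k_subsets "\<lambda>J. norm (sum l J) - tangent J"] by blast
  with tangent_le(2)[OF J_mem] have r: "norm (sum centred J) = R" "norm (sum l J) = K / R" by auto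
  have d: "sum centred J = sum x J" by (simp add: s centred_def)
  have lx: "sum l J \<bullet> sum x J = K" using inner_centred[OF J] by (simp add: K_def d)
  then have "sum l J \<bullet> sum x J = norm (sum l J) * norm (sum x J)"
    using r constants_pos(2) by (simp add: d)
  \<comment> \<open>Equality in Cauchy-Schwarz makes the two vectors parallel, so products with
    \<open>sum x J\<close> can be read off from the dual relations for
    \<open>sum l J\<close>.\<close>
  then have "(K / R) *\<^sub>R sum x J = R *\<^sub>R sum l J"
    using r unfolding norm_cauchy_schwarz_eq d by simp
  then have par: "(K / R) * (sum x J \<bullet> y) = R * (sum l J \<bullet> y)" for y
    by (metis inner_scaleR_left)
  \<comment> \<open>The centroid is now the origin, so \<open>inner_sum_nodes\<close> and
    \<open>inner_centred\<close> evaluate the same product; comparing them determines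
    \<open>sum c J\<close>.\<close>
  have "real k * (1 - sum c J) = real k * (1 - real k / (real n + 1))"
    using inner_sum_nodes[OF J] lx by (simp add: K_def field_simps)
  then have c: "1 - sum c J = 1 - real k / (real n + 1)"
    using k by (simp only: mult_cancel_left) auto
  have lj: "sum l J \<bullet> x j = - (real k / (real n + 1))"
    using dual_sum[OF J(1), of j] j c by simp
  have "K * (sum x J \<bullet> x j) = R\<^sup>2 * (sum l J \<bullet> x j)"
    using par[of "x j"] constants_pos(2) by (simp add: field_simps power2_eq_square)
  also have "\<dots> = K * (- real k / real n)"
    unfolding constants_pos(4) lj K_def by simp
  finally show "sum x J \<bullet> x j = - real k / real n"
    using constants_pos(1) by (metis less_irrefl mult_left_cancel)
qed

lemma psi_eq_imp_regular:
  assumes M: "M = psi n (real k)" and kn: "k \<le> n - 1 \<or> n = 1"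
    and i: "i \<in> I" and m: "m \<in> I" and "i \<noteq> m"
  shows "x i \<bullet> x m = - 1 / real n"
proof -
  have swap: "x j \<bullet> x m = x i \<bullet> x m" if j: "j \<in> I - {m}" for j
  proof (cases "i = j")
    case False
    \<comment> \<open>Three distinct indices force \<open>n \<ge> 2\<close>, hence
      \<open>k \<le> n - 1\<close>; this leaves room for \<open>k - 1\<close> further indices among
      the other \<open>n - 2\<close>.\<close>
    have "card {i, j, m} = 3" using False j \<open>i \<noteq> m\<close> by auto
    then have "card (I - {i, j, m}) = n - 2"
      using i j m by (subst card_Diff_subset) (auto simp: card_I)
    moreover have "card {i, j, m} \<le> card I" using i j m by (intro card_mono) auto
    then have "n \<ge> 2" using \<open>card {i, j, m} = 3\<close> by (simp add: card_I)
    ultimately have "k - 1 \<le> card (I - {i, j, m})" using kn by auto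
    then obtain J where J: "J \<subseteq> I - {i, j, m}" "card J = k - 1" "finite J"
      by (rule obtain_subset_with_card_n)
    \<comment> \<open>The two \<open>k\<close>-sets differ by exchanging \<open>i\<close> for
      \<open>j\<close> and both avoid \<open>m\<close>. Subtracting the two equations leaves
      \<open>x i \<bullet> x m = x j \<bullet> x m\<close>.\<close>
    have "sum x (insert i J) \<bullet> x m = - real k / real n" "sum x (insert j J) \<bullet> x m = - real k / real n"
      using J i j m k \<open>i \<noteq> m\<close> by (intro psi_eqD(3)[OF M]; auto simp: card_insert_if)+
    moreover have "i \<notin> J" "j \<notin> J" using J by auto
    ultimately show ?thesis using J(3) by (simp add: inner_add_left)
  qed simp
  \<comment> \<open>The common product is found by pairing the vanishing sum of the nodes with
    \<open>x m\<close>: one term is \<open>1\<close> and the other \<open>n\<close> are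
    equal.\<close>
  have "0 = sum x I \<bullet> x m" by (simp add: psi_eqD(1)[OF M])
  also have "\<dots> = x m \<bullet> x m + (\<Sum>j\<in>I - {m}. x j \<bullet> x m)"
    unfolding inner_sum_left using m by (simp add: sum.remove)
  also have "x m \<bullet> x m = 1"
    using psi_eqD(2)[OF M m] by (simp add: power2_norm_eq_inner[symmetric])
  also have "(\<Sum>j\<in>I - {m}. x j \<bullet> x m) = (\<Sum>j\<in>I - {m}. x i \<bullet> x m)"
    by (rule sum.cong[OF refl swap])
  also have "\<dots> = real n * (x i \<bullet> x m)" using m by (simp add: card_I)
  finally show ?thesis using n_pos by (simp add: field_simps)
qed

end

end

section \<open>The function \<open>psi\<close>\<close>

text \<open>In terms of the offset \<open>u\<close> from the midpoint, \<open>t\<close> and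
  \<open>n + 1 - t\<close> are \<open>(n + 1) / 2\<close> times \<open>1 - u\<close> and
  \<open>1 + u\<close>, so the product under the root is a difference of squares.\<close>

lemma psi_eq_of_offset:
  assumes "0 \<le> t" "t \<le> real n + 1"
  defines "u \<equiv> 1 - 2 * t / (real n + 1)"
  shows "psi n t = sqrt (real n) * sqrt (1 - u\<^sup>2) + \<bar>u\<bar>"
proof -
  have "t = (real n + 1) / 2 * (1 - u)" by (simp add: u_def field_simps)
  moreover have "real n + 1 - t = (real n + 1) / 2 * (1 + u)" by (simp add: u_def field_simps)
  ultimately have "t * (real n + 1 - t) = ((real n + 1) / 2 * (1 - u)) * ((real n + 1) / 2 * (1 + u))"
    by (rule arg_cong2[where f = "(*)"])
  also have "\<dots> = ((real n + 1) / 2)\<^sup>2 * (1 - u\<^sup>2)"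
    by (simp add: power2_eq_square algebra_simps)
  finally have "t * (real n + 1 - t) = ((real n + 1) / 2)\<^sup>2 * (1 - u\<^sup>2)" .
  then have X: "sqrt (t * (real n + 1 - t)) = (real n + 1) / 2 * sqrt (1 - u\<^sup>2)"
    by (simp add: real_sqrt_mult)
  have "2 * sqrt (real n) / (real n + 1) * sqrt (t * (real n + 1 - t)) = sqrt (real n) * sqrt (1 - u\<^sup>2)"
    unfolding X by simp
  then show ?thesis by (simp only: psi_def u_def)
qed

lemma psi_reflect: "psi n (real n + 1 - t) = psi n t"
proof -
  have key: "1 - 2 * (real n + 1 - t) / (real n + 1) = - (1 - 2 * t / (real n + 1))"
    by (simp add: field_simps)
  show ?thesis unfolding psi_def key by (simp only: abs_minus_cancel) (simp add: mult.commute)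
qed

text \<open>
  By Cauchy-Schwarz \<open>sqrt n * sqrt (1 - u\<^sup>2) + u\<close> is maximal at \<open>u = 1 / sqrt (n + 1)\<close>.
\<close>

lemma offset_unimodal:
  fixes p q :: real
  assumes "0 \<le> q" "q \<le> p" "p \<le> 1" "n \<ge> 1"
  shows "1 / sqrt (real n + 1) \<le> q \<Longrightarrow>
           sqrt (real n) * sqrt (1 - p\<^sup>2) + p \<le> sqrt (real n) * sqrt (1 - q\<^sup>2) + q"
    and "p \<le> 1 / sqrt (real n + 1) \<Longrightarrow>
           sqrt (real n) * sqrt (1 - q\<^sup>2) + q \<le> sqrt (real n) * sqrt (1 - p\<^sup>2) + p"
proof -
  define A B r s where "A = sqrt (1 - p\<^sup>2)" and "B = sqrt (1 - q\<^sup>2)"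
    and "r = 1 / sqrt (real n + 1)" and "s = sqrt (real n)"
  have s: "s > 0" "s\<^sup>2 = real n" using assms by (auto simp: s_def)
  have r: "r > 0" "r\<^sup>2 = 1 / (real n + 1)" by (auto simp: r_def power_divide)
  have pq: "q\<^sup>2 \<le> p\<^sup>2" "p\<^sup>2 \<le> 1" using assms by (auto simp: power_mono power_le_one)
  have AB: "0 \<le> A" "A \<le> B" "A\<^sup>2 = 1 - p\<^sup>2" "B\<^sup>2 = 1 - q\<^sup>2"
    using pq by (auto simp: A_def B_def)
  \<comment> \<open>Rationalising the difference of roots reduces comparing
    \<open>s * (B - A)\<close> with \<open>p - q\<close> to comparing \<open>s * (p + q)\<close>
    with \<open>A + B\<close>.\<close>
  have key: "s * (B - A) * (A + B) = (p - q) * (s * (p + q))"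
  proof -
    have "s * (B - A) * (A + B) = s * (B\<^sup>2 - A\<^sup>2)" by (simp add: power2_eq_square algebra_simps)
    also have "\<dots> = (p - q) * (s * (p + q))" unfolding AB by (simp add: power2_eq_square algebra_simps)
    finally show ?thesis .
  qed
  \<comment> \<open>At the maximiser \<open>r\<close> the root \<open>sqrt (1 - r\<^sup>2)\<close>
    equals \<open>s * r\<close>; monotonicity then compares \<open>A\<close> and \<open>B\<close>
    with \<open>s * r\<close>.\<close>
  have sr: "(s * r)\<^sup>2 = 1 - r\<^sup>2"
    unfolding power_mult_distrib s r by (simp add: field_simps)
  { assume "r \<le> q"
    then have "r\<^sup>2 \<le> q\<^sup>2" using r by (intro power_mono) auto
    then have "B\<^sup>2 \<le> (s * r)\<^sup>2" unfolding sr AB by simp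
    then have "B \<le> s * r" using s r by (intro power2_le_imp_le[of B]) auto
    moreover have "s * (2 * r) \<le> s * (p + q)" using \<open>r \<le> q\<close> assms s by (intro mult_left_mono) auto
    ultimately have "A + B \<le> s * (p + q)" using AB by linarith
    then have le: "(p - q) * (A + B) \<le> s * (B - A) * (A + B)"
      unfolding key using assms by (intro mult_left_mono) auto
    have "p - q \<le> s * (B - A)"
    \<comment> \<open>The factor \<open>A + B\<close> cannot be cancelled if it is \<open>0\<close>,
      but then \<open>p = q = 1\<close>.\<close>
    proof (cases "A + B = 0")
      case True
      then have "A = 0" "B = 0" using AB by linarith+
      then have "p\<^sup>2 = 1" "q\<^sup>2 = 1" using AB by auto
      then have "p = 1" "q = 1" using assms by (auto simp: power2_eq_1_iff)
      then show ?thesis using \<open>A = 0\<close> \<open>B = 0\<close> by simp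
    next
      case False
      then show ?thesis using le AB by (simp add: mult_le_cancel_right)
    qed
    then have "s * A + p \<le> s * B + q" by (simp add: algebra_simps) }
  then show "1 / sqrt (real n + 1) \<le> q \<Longrightarrow>
           sqrt (real n) * sqrt (1 - p\<^sup>2) + p \<le> sqrt (real n) * sqrt (1 - q\<^sup>2) + q"
    by (simp add: A_def B_def r_def s_def)
  { assume "p \<le> r"
    then have "p\<^sup>2 \<le> r\<^sup>2" using assms by (intro power_mono) auto
    then have "(s * r)\<^sup>2 \<le> A\<^sup>2" unfolding sr AB by simp
    then have "s * r \<le> A" using AB by (intro power2_le_imp_le[of "s * r"]) auto
    moreover have "s * (p + q) \<le> s * (2 * r)" using \<open>p \<le> r\<close> assms s by (intro mult_left_mono) auto
    moreover have "s * r > 0" using s r by simp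
    ultimately have "s * (p + q) \<le> A + B" "A + B > 0" using AB by linarith+
    then have "s * (B - A) * (A + B) \<le> (p - q) * (A + B)"
      unfolding key using assms by (intro mult_left_mono) auto
    then have "s * (B - A) \<le> p - q" using \<open>A + B > 0\<close> by (simp add: mult_le_cancel_right)
    then have "s * B + q \<le> s * A + p" by (simp add: algebra_simps) }
  then show "p \<le> 1 / sqrt (real n + 1) \<Longrightarrow>
           sqrt (real n) * sqrt (1 - q\<^sup>2) + q \<le> sqrt (real n) * sqrt (1 - p\<^sup>2) + p"
    by (simp add: A_def B_def r_def s_def)
qed

text \<open>On the left half the offsets are non-negative, so \<open>offset_unimodal\<close>
  applies. The offset decreases in its argument, which reverses the order, and the peak
  \<open>1 / sqrt (n + 1)\<close> corresponds to
  \<open>(n + 1) / 2 - sqrt (n + 1) / 2\<close>.\<close>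

lemma psi_unimodal:
  assumes "0 \<le> s" "s \<le> t" "t \<le> (real n + 1) / 2" "n \<ge> 1"
  shows "t \<le> (real n + 1) / 2 - sqrt (real n + 1) / 2 \<Longrightarrow> psi n s \<le> psi n t"
    and "(real n + 1) / 2 - sqrt (real n + 1) / 2 \<le> s \<Longrightarrow> psi n t \<le> psi n s"
proof -
  define p q where "p = 1 - 2 * s / (real n + 1)" and "q = 1 - 2 * t / (real n + 1)"
  define r where "r = sqrt (real n + 1)"
  have r: "r > 0" "real n + 1 = r * r" by (auto simp: r_def)
  have "2 * s / (real n + 1) \<le> 2 * t / (real n + 1)"
    using assms by (intro divide_right_mono) auto
  then have pq: "0 \<le> q" "q \<le> p" "p \<le> 1"
    using assms unfolding p_def q_def by (auto simp: field_simps)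
  have psi: "psi n s = sqrt (real n) * sqrt (1 - p\<^sup>2) + p" "psi n t = sqrt (real n) * sqrt (1 - q\<^sup>2) + q"
    using psi_eq_of_offset[of s n] psi_eq_of_offset[of t n] pq assms by (auto simp: p_def q_def)
  { assume "t \<le> (real n + 1) / 2 - sqrt (real n + 1) / 2"
    then have "1 / sqrt (real n + 1) \<le> q"
      unfolding q_def r_def[symmetric] r(2) using r(1) by (simp add: field_simps)
    then show "psi n s \<le> psi n t" unfolding psi by (rule offset_unimodal(1)[OF pq assms(4)]) }
  { assume "(real n + 1) / 2 - sqrt (real n + 1) / 2 \<le> s"
    then have "r * (r * r) \<le> r * (r + 2 * s)"
      unfolding r_def[symmetric] r(2) using r(1) by (intro mult_left_mono) auto
    then have "p \<le> 1 / sqrt (real n + 1)"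
      unfolding p_def r_def[symmetric] r(2) using r(1) by (simp add: field_simps)
    then show "psi n t \<le> psi n s" unfolding psi by (rule offset_unimodal(2)[OF pq assms(4)]) }
qed

section \<open>The maximum of \<open>psi\<close> over the integers\<close>

definition psi_max :: "nat \<Rightarrow> real" where
  "psi_max n = max (psi n (real_of_int (a_opt n))) (psi n (real_of_int (a_opt n + 1)))"

lemma a_opt_bounds:
  assumes "n \<ge> 1"
  shows "0 \<le> a_opt n"
    and "real_of_int (a_opt n) \<le> (real n + 1) / 2 - sqrt (real n + 1) / 2"
    and "(real n + 1) / 2 - sqrt (real n + 1) / 2 < real_of_int (a_opt n) + 1"
    and "n \<ge> 2 \<Longrightarrow> a_opt n + 1 < int n"
    and "a_opt n < int n"
proof -
  have "sqrt (real n + 1) \<le> real n + 1"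
    by (rule real_le_lsqrt) (auto simp: power2_eq_square algebra_simps)
  then show "0 \<le> a_opt n" unfolding a_opt_def by (simp add: field_simps)
  show le: "real_of_int (a_opt n) \<le> (real n + 1) / 2 - sqrt (real n + 1) / 2"
    unfolding a_opt_def by linarith
  show "(real n + 1) / 2 - sqrt (real n + 1) / 2 < real_of_int (a_opt n) + 1"
    unfolding a_opt_def by linarith
  define r where "r = sqrt (real n + 1)"
  have "r > 1" using assms by (simp add: r_def)
  moreover have "2 * A < N" if "A \<le> (N + 1) / 2 - r / 2" "1 < r" for A N :: real
    using that by (simp add: field_simps)
  \<comment> \<open>Since \<open>sqrt (n + 1) > 1\<close>, the floor lies below
    \<open>n / 2\<close>; for \<open>n \<ge> 2\<close> this keeps \<open>a_opt n + 1\<close> at most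
    \<open>n - 1\<close>, as the exchange argument requires.\<close>
  ultimately have *: "2 * real_of_int (a_opt n) < real n" using le unfolding r_def by blast
  then show "a_opt n < int n" by linarith
  assume "n \<ge> 2"
  show "a_opt n + 1 < int n"
  proof (cases "n = 2")
    case True
    then show ?thesis using * by linarith
  next
    case False
    then show ?thesis using * \<open>n \<ge> 2\<close> by linarith
  qed
qed

text \<open>The peak lies between \<open>a_opt n\<close> and \<open>a_opt n + 1\<close>, so
  unimodality settles the integers in the left half; reflection carries the rest there.\<close>

lemma psi_le_psi_max:
  assumes "n \<ge> 1" "k \<le> n + 1"
  shows "psi n (real k) \<le> psi_max n"
proof -
  note a = a_opt_bounds[OF assms(1)]
  have *: "psi n (real j) \<le> psi_max n" if j: "real j \<le> (real n + 1) / 2" for j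
  proof (cases "int j \<le> a_opt n")
    case True
    have "real_of_int (a_opt n) \<le> (real n + 1) / 2" using a(2) real_sqrt_ge_zero[of "real n + 1"] by linarith
    then have "psi n (real j) \<le> psi n (real_of_int (a_opt n))"
      using True a(2) assms by (intro psi_unimodal(1)) auto
    then show ?thesis by (simp add: psi_max_def)
  next
    case False
    then have "real_of_int (a_opt n + 1) \<le> real j" by linarith
    then have "psi n (real j) \<le> psi n (real_of_int (a_opt n + 1))"
      using j a(1,3) assms by (intro psi_unimodal(2)) auto
    then show ?thesis by (simp add: psi_max_def)
  qed
  show ?thesis
  proof (cases "real k \<le> (real n + 1) / 2")
    case False
    then have "psi n (real (n + 1 - k)) \<le> psi_max n" using assms by (intro *) (simp add: of_nat_diff)
    then show ?thesis using psi_reflect[of n "real k"] assms by (simp add: of_nat_diff add.commute)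
  qed (rule *)
qed

text \<open>Supplies a size \<open>k\<close> for which both the averaging and the exchange argument
  work. If \<open>a_opt n = 0\<close>, the inadmissible size \<open>0\<close> is avoided because
  \<open>psi n 0 \<le> psi n 1\<close>.\<close>

lemma psi_max_attained:
  assumes "n \<ge> 1"
  obtains k where "1 \<le> k" "k \<le> n" "k \<le> n - 1 \<or> n = 1" "psi_max n = psi n (real k)"
proof -
  note a = a_opt_bounds[OF assms]
  have "psi n 1 = 2 * real n / (real n + 1) + \<bar>1 - 2 / (real n + 1)\<bar>"
    by (simp add: psi_def)
  moreover have "2 * real n / (real n + 1) + (1 - 2 / (real n + 1)) \<ge> 1"
    using assms by (simp add: divide_right_mono)
  moreover have "psi n 0 = 1" by (simp add: psi_def)
  ultimately have 01: "psi n 0 \<le> psi n 1" by linarith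
  consider "psi_max n = psi n (real_of_int (a_opt n + 1))"
    | "a_opt n \<noteq> 0" "psi_max n = psi n (real_of_int (a_opt n))"
  proof (cases "psi n (real_of_int (a_opt n)) \<le> psi n (real_of_int (a_opt n + 1))")
    case True
    then show ?thesis by (intro that(1)) (simp add: psi_max_def)
  next
    case False
    with 01 have "a_opt n \<noteq> 0" by auto
    with False show ?thesis by (intro that(2)) (simp_all add: psi_max_def)
  qed
  note cases = this
  obtain m where m: "a_opt n = int m" using a(1) by (metis nonneg_int_cases)
  have mn: "m < n" "n \<ge> 2 \<Longrightarrow> m + 1 < n" using a(4,5) m by linarith+
  from cases show thesis
  proof cases
    case 1
    then have "psi_max n = psi n (real (m + 1))" by (simp add: m add.commute)
    then show thesis by (rule that[rotated 3]) (use mn assms in auto)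
  next
    case 2
    then show thesis using mn assms m by (intro that[of m]) auto
  qed
qed

section \<open>The Lebesgue function of the inscribed regular simplex\<close>

lemma norm_sq_sum_regular:
  fixes x :: "'b \<Rightarrow> 'a::real_inner"
  assumes "finite J" "card J = k" "n \<ge> 1"
    and unit: "\<And>i. i \<in> J \<Longrightarrow> norm (x i) = 1"
    and inner: "\<And>i j. i \<in> J \<Longrightarrow> j \<in> J \<Longrightarrow> i \<noteq> j \<Longrightarrow> x i \<bullet> x j = - 1 / real n"
  shows "(norm (sum x J))\<^sup>2 = real k * (real n + 1 - real k) / real n"
proof -
  have "(norm (sum x J))\<^sup>2 = (\<Sum>i\<in>J. \<Sum>j\<in>J. x i \<bullet> x j)"
    unfolding power2_norm_eq_inner by (simp only: inner_sum_left, simp only: inner_sum_right)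
  \<comment> \<open>The Gram matrix is \<open>1 + 1 / n\<close> times the identity minus
    \<open>1 / n\<close> times the all-ones matrix.\<close>
  also have "\<dots> = (\<Sum>i\<in>J. \<Sum>j\<in>J. - 1 / real n + (if i = j then 1 + 1 / real n else 0))"
  proof (intro sum.cong refl)
    fix i j assume "i \<in> J" "j \<in> J"
    then show "x i \<bullet> x j = - 1 / real n + (if i = j then 1 + 1 / real n else 0)"
      using unit[of i] inner[of i j] by (auto simp: power2_norm_eq_inner[symmetric])
  qed
  also have "\<dots> = (\<Sum>i\<in>J. 1 + 1 / real n - real k / real n)"
    using assms(1,2) by (intro sum.cong refl) (simp add: sum.distrib sum_subtractf)
  also have "\<dots> = real k * (real n + 1 - real k) / real n"
    using assms(2,3) by (simp add: field_simps)
  finally show ?thesis .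
qed

text \<open>If \<open>J\<close> collects the coordinates that are negative at \<open>y\<close>, the
  sum of absolute values is affine in \<open>sum x J \<bullet> y\<close>. Cauchy-Schwarz bounds it
  by \<open>psi n k\<close> with \<open>k = card J\<close>, which depends on \<open>y\<close> only
  through \<open>k\<close>.\<close>

lemma lebesgue_function_regular_le:
  fixes x :: "'b \<Rightarrow> 'a::real_inner"
  assumes "finite I" "card I = n + 1" "n \<ge> 1"
    and unit: "\<And>i. i \<in> I \<Longrightarrow> norm (x i) = 1"
    and inner: "\<And>i j. i \<in> I \<Longrightarrow> j \<in> I \<Longrightarrow> i \<noteq> j \<Longrightarrow> x i \<bullet> x j = - 1 / real n"
    and y: "norm y \<le> 1"
  shows "(\<Sum>i\<in>I. \<bar>(real n / (real n + 1)) *\<^sub>R x i \<bullet> y + 1 / (real n + 1)\<bar>) \<le> psi_max n"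
proof -
  define L where "L i = (real n / (real n + 1)) *\<^sub>R x i \<bullet> y + 1 / (real n + 1)" for i
  define J where "J = {i \<in> I. L i < 0}"
  define k where "k = card J"
  have J: "J \<subseteq> I" "finite J" using assms(1) by (auto simp: J_def)
  have k: "k \<le> n + 1" using card_mono[OF assms(1) J(1)] assms(2) by (simp add: k_def)
  have "(norm (sum x I))\<^sup>2 = 0"
    using norm_sq_sum_regular[OF assms(1-3), of x] unit inner by simp
  then have s: "sum x I = 0" by simp
  have sumL: "sum L A = (real n / (real n + 1)) * (sum x A \<bullet> y) + real (card A) / (real n + 1)" for A
    by (simp add: L_def sum.distrib sum_distrib_left inner_sum_left)
  have "(\<Sum>i\<in>I. \<bar>L i\<bar>) = (\<Sum>i\<in>I. L i - 2 * (if L i < 0 then L i else 0))"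
    by (intro sum.cong) auto
  also have "\<dots> = sum L I - 2 * sum L J"
    using assms(1) by (simp add: sum_subtractf sum_distrib_left[symmetric] J_def sum.inter_filter)
  also have "\<dots> = 1 - 2 * (real k / (real n + 1)) + 2 * (real n / (real n + 1)) * (sum x J \<bullet> (- y))"
    unfolding sumL k_def[symmetric] s using assms(2) by (simp add: algebra_simps)
  also have "\<dots> \<le> \<bar>1 - 2 * (real k / (real n + 1))\<bar> + 2 * (real n / (real n + 1)) * norm (sum x J)"
  proof (intro add_mono mult_left_mono)
    have "sum x J \<bullet> (- y) \<le> norm (sum x J) * norm (- y)" by (rule norm_cauchy_schwarz)
    also have "\<dots> \<le> norm (sum x J) * 1" using y by (intro mult_left_mono) auto
    finally show "sum x J \<bullet> (- y) \<le> norm (sum x J)" by simp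
  qed auto
  also have "norm (sum x J) = sqrt (real k * (real n + 1 - real k) / real n)"
  proof -
    have "(norm (sum x J))\<^sup>2 = real k * (real n + 1 - real k) / real n"
      by (intro norm_sq_sum_regular unit inner) (use J assms(3) in \<open>auto simp: k_def\<close>)
    then show ?thesis by (metis norm_ge_zero real_sqrt_unique)
  qed
  also have "\<bar>1 - 2 * (real k / (real n + 1))\<bar>
        + 2 * (real n / (real n + 1)) * sqrt (real k * (real n + 1 - real k) / real n) = psi n (real k)"
  proof -
    have "real n / sqrt (real n) = sqrt (real n)" by (simp add: real_div_sqrt)
    then show ?thesis unfolding psi_def real_sqrt_divide
      by (metis (no_types, opaque_lifting) add.commute times_divide_eq_left times_divide_eq_right)
  qed
  also have "\<dots> \<le> psi_max n" using assms(3) k by (rule psi_le_psi_max)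
  finally show ?thesis by (simp add: L_def)
qed

section \<open>Interpolation projectors on the ball\<close>

definition dual_basis :: "(nat \<Rightarrow> real^'n) \<Rightarrow> (nat \<Rightarrow> real^'n) \<Rightarrow> (nat \<Rightarrow> real) \<Rightarrow> bool" where
  "dual_basis x l c \<longleftrightarrow>
     (\<forall>i\<in>{1..CARD('n) + 1}. \<forall>j\<in>{1..CARD('n) + 1}. l i \<bullet> x j + c i = (if i = j then 1 else 0))"

lemma dual_basisD:
  fixes x :: "nat \<Rightarrow> real^'n"
  assumes "dual_basis x l c" "i \<in> {1..CARD('n) + 1}" "j \<in> {1..CARD('n) + 1}"
  shows "l i \<bullet> x j + c i = (if i = j then 1 else 0)"
  using assms by (simp add: dual_basis_def)

declare sum.cl_ivl_Suc [simp del]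

lemma norm_node:
  fixes x :: "nat \<Rightarrow> real^'n"
  assumes "i \<in> {1..CARD('n) + 1}"
  shows "nodes x \<subseteq> cball 0 1 \<Longrightarrow> norm (x i) \<le> 1" and "nodes x \<subseteq> sphere 0 1 \<Longrightarrow> norm (x i) = 1"
  using assms imageI[of i "{1..CARD('n) + 1}" x] unfolding nodes_def by (force, force)

lemma inj_on_nodes:
  assumes "admissible_nodes (x :: nat \<Rightarrow> real^'n)"
  shows "inj_on x {1..CARD('n) + 1}"
  using assms unfolding admissible_nodes_def nondegenerate_simplex_vertices_def nodes_def
  by (intro eq_card_imp_inj_on) auto

text \<open>The \<open>n + 1\<close> affinely independent nodes span the whole space affinely, so
  they lie in no hyperplane.\<close>

lemma affine_zero_on_nodes:
  fixes a :: "real^'n"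
  assumes "admissible_nodes (x :: nat \<Rightarrow> real^'n)"
    and 0: "\<And>j. j \<in> {1..CARD('n) + 1} \<Longrightarrow> a \<bullet> x j + b = 0"
  shows "a = 0" "b = 0"
proof -
  have V: "\<not> affine_dependent (nodes x)" "card (nodes x) = Suc DIM(real^'n)"
    using assms(1) by (auto simp: admissible_nodes_def nondegenerate_simplex_vertices_def)
  have "affine hull (nodes x) \<subseteq> {y. a \<bullet> y = - b}"
  proof (rule hull_minimal)
    show "nodes x \<subseteq> {y. a \<bullet> y = - b}" using 0 by (force simp: nodes_def)
  qed (rule affine_hyperplane)
  then have *: "a \<bullet> y = - b" for y
    using affine_independent_span_eq[OF V] by auto
  from *[of 0] show "b = 0" by simp
  with *[of a] show "a = 0" by simp
qed

text \<open>Interpolation is exact on affine forms, stated for gradient and constant term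
  separately: both sides agree at the nodes. The choice \<open>a = 0\<close>, \<open>b = 1\<close>
  gives \<open>sum l = 0\<close> and \<open>sum c = 1\<close>.\<close>

lemma barycentric_reproduces:
  fixes a :: "real^'n"
  assumes adm: "admissible_nodes x"
    and dual: "dual_basis x l c"
  shows "(\<Sum>i = 1..CARD('n) + 1. (a \<bullet> x i + b) *\<^sub>R l i) = a"
    and "(\<Sum>i = 1..CARD('n) + 1. (a \<bullet> x i + b) * c i) = b"
proof -
  let ?I = "{1..CARD('n) + 1}"
  let ?l = "\<Sum>i\<in>?I. (a \<bullet> x i + b) *\<^sub>R l i" and ?c = "\<Sum>i\<in>?I. (a \<bullet> x i + b) * c i"
  have 0: "(?l - a) \<bullet> x j + (?c - b) = 0" if j: "j \<in> ?I" for j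
  proof -
    have "?l \<bullet> x j + ?c = (\<Sum>i\<in>?I. (a \<bullet> x i + b) * (l i \<bullet> x j + c i))"
      unfolding inner_sum_left distrib_left sum.distrib by simp
    also have "\<dots> = (\<Sum>i\<in>?I. if i = j then a \<bullet> x i + b else 0)"
      by (intro sum.cong refl) (use j in \<open>simp only: dual_basisD[OF dual], simp\<close>)
    also have "\<dots> = a \<bullet> x j + b" using j by simp
    finally show ?thesis by (simp add: inner_diff_left)
  qed
  show "?l = a" using affine_zero_on_nodes(1)[OF adm 0] by simp
  show "?c = b" using affine_zero_on_nodes(2)[OF adm 0] by simp
qed

lemma projector_formula:
  fixes x :: "nat \<Rightarrow> real^'n"
  assumes P: "interpolation_projector x P"
    and dual: "dual_basis x l c"
    and f: "f \<in> C_ball"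
  shows "P f y = (\<Sum>i = 1..CARD('n) + 1. f (x i) * (l i \<bullet> y + c i))"
proof -
  let ?I = "{1..CARD('n) + 1}"
  have adm: "admissible_nodes x" using P by (simp add: interpolation_projector_def)
  have "P f \<in> Pi1" and eq: "\<And>j. j \<in> ?I \<Longrightarrow> P f (x j) = f (x j)"
    using P f by (auto simp: interpolation_projector_def)
  then obtain a b where p: "P f = (\<lambda>y. a \<bullet> y + b)" by (auto simp: Pi1_def)
  have "P f y = (\<Sum>i\<in>?I. (a \<bullet> x i + b) *\<^sub>R l i) \<bullet> y + (\<Sum>i\<in>?I. (a \<bullet> x i + b) * c i)"
    unfolding barycentric_reproduces[OF adm dual] by (simp add: p)
  also have "\<dots> = (\<Sum>i\<in>?I. (a \<bullet> x i + b) * (l i \<bullet> y + c i))"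
    unfolding inner_sum_left distrib_left sum.distrib by simp
  also have "\<dots> = (\<Sum>i\<in>?I. f (x i) * (l i \<bullet> y + c i))"
    using eq unfolding p by (intro sum.cong refl) simp
  finally show ?thesis .
qed

text \<open>The projector itself yields the coordinates: they are its values on continuous functions
  that are \<open>1\<close> at one node and \<open>0\<close> at the others.\<close>

lemma ex_dual_basis:
  fixes x :: "nat \<Rightarrow> real^'n"
  assumes P: "interpolation_projector x P"
  obtains l c where "dual_basis x l c"
proof -
  let ?I = "{1..CARD('n) + 1}"
  have inj: "inj_on x ?I"
    using P by (intro inj_on_nodes) (simp add: interpolation_projector_def)
  \<comment> \<open>Each factor vanishes at one of the other nodes and equals \<open>1\<close> at
    \<open>x i\<close>; the denominators are non-zero because the nodes are distinct.\<close>
  define f where "f i y = (\<Prod>k\<in>?I - {i}. dist y (x k) / dist (x i) (x k))" for i y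
  have "\<forall>i. \<exists>a b. P (f i) = (\<lambda>y. a \<bullet> y + b)" and eq: "\<And>i j. j \<in> ?I \<Longrightarrow> P (f i) (x j) = f i (x j)"
  proof -
    have C: "f i \<in> C_ball" for i
      unfolding C_ball_def f_def divide_inverse
      by (auto intro!: continuous_on_prod continuous_on_mult continuous_on_dist continuous_on_id continuous_on_const)
    then show "\<forall>i. \<exists>a b. P (f i) = (\<lambda>y. a \<bullet> y + b)"
      using P unfolding interpolation_projector_def Pi1_def by blast
    show "\<And>i j. j \<in> ?I \<Longrightarrow> P (f i) (x j) = f i (x j)"
      using P C by (simp add: interpolation_projector_def)
  qed
  then obtain l c where lc: "\<And>i. P (f i) = (\<lambda>y. l i \<bullet> y + c i)" by metis
  have "f i (x j) = (if i = j then 1 else 0)" if "i \<in> ?I" "j \<in> ?I" for i j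
  proof (cases "i = j")
    case True
    have "dist (x i) (x k) / dist (x i) (x k) = 1" if "k \<in> ?I - {i}" for k
      using inj \<open>i \<in> ?I\<close> that by (auto dest: inj_onD)
    then show ?thesis using True by (simp add: f_def)
  next
    case False
    then show ?thesis using that unfolding f_def by (auto intro!: prod_zero bexI[of _ j])
  qed
  then show thesis using that[of l c] eq by (simp add: lc dual_basis_def)
qed

section \<open>Norms on the ball\<close>

lemma abs_le_ball_norm:
  assumes "f \<in> C_ball" "y \<in> cball 0 1"
  shows "\<bar>f y\<bar> \<le> ball_norm f"
proof -
  have "compact ((\<lambda>x. \<bar>f x\<bar>) ` cball 0 1)"
    using assms(1) by (intro compact_continuous_image continuous_on_rabs) (auto simp: C_ball_def)
  then have "bdd_above ((\<lambda>x. \<bar>f x\<bar>) ` cball 0 1)"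
    by (intro bounded_imp_bdd_above compact_imp_bounded)
  then show ?thesis unfolding ball_norm_def using assms(2) by (intro cSUP_upper)
qed

lemma ball_norm_le:
  assumes "\<And>y. y \<in> cball 0 1 \<Longrightarrow> \<bar>f y\<bar> \<le> B"
  shows "ball_norm (f :: real^'n \<Rightarrow> real) \<le> B"
  unfolding ball_norm_def by (rule cSUP_least) (use assms in auto)

lemma Pi1_subset_C_ball: "Pi1 \<subseteq> C_ball"
  by (auto simp: Pi1_def C_ball_def intro!: continuous_intros)

lemma ball_norm_projector_le:
  fixes x :: "nat \<Rightarrow> real^'n"
  assumes P: "interpolation_projector x P"
    and dual: "dual_basis x l c"
    and bound: "\<And>y. norm y \<le> 1 \<Longrightarrow> (\<Sum>i = 1..CARD('n) + 1. \<bar>l i \<bullet> y + c i\<bar>) \<le> B"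
    and f: "f \<in> C_ball" "ball_norm f \<le> 1"
  shows "ball_norm (P f) \<le> B"
proof (rule ball_norm_le)
  fix y :: "real^'n" assume "y \<in> cball 0 1"
  then have y: "norm y \<le> 1" by simp
  have "\<bar>P f y\<bar> \<le> (\<Sum>i = 1..CARD('n) + 1. \<bar>f (x i) * (l i \<bullet> y + c i)\<bar>)"
    unfolding projector_formula[OF P dual f(1)] by (rule sum_abs)
  also have "\<dots> \<le> (\<Sum>i = 1..CARD('n) + 1. \<bar>l i \<bullet> y + c i\<bar>)"
  proof (rule sum_mono)
    fix i assume "i \<in> {1..CARD('n) + 1}"
    then have "x i \<in> cball 0 1"
      using P norm_node(1) by (auto simp: interpolation_projector_def admissible_nodes_def)
    then have "\<bar>f (x i)\<bar> \<le> 1" using abs_le_ball_norm f by fastforce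
    then show "\<bar>f (x i) * (l i \<bullet> y + c i)\<bar> \<le> \<bar>l i \<bullet> y + c i\<bar>"
      by (simp add: abs_mult mult_left_le_one_le)
  qed
  also have "\<dots> \<le> B" using y by (rule bound)
  finally show "\<bar>P f y\<bar> \<le> B" .
qed

lemma projector_norm_le:
  fixes x :: "nat \<Rightarrow> real^'n"
  assumes P: "interpolation_projector x P"
    and dual: "dual_basis x l c"
    and bound: "\<And>y. norm y \<le> 1 \<Longrightarrow> (\<Sum>i = 1..CARD('n) + 1. \<bar>l i \<bullet> y + c i\<bar>) \<le> B"
  shows "projector_norm P \<le> B"
  unfolding projector_norm_def
proof (rule cSUP_least)
  have "(\<lambda>y :: real^'n. 0) \<in> {f \<in> C_ball. ball_norm f \<le> 1}"
    by (auto simp: C_ball_def intro!: ball_norm_le)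
  then show "{f \<in> C_ball. ball_norm (f :: real^'n \<Rightarrow> real) \<le> 1} \<noteq> {}" by blast
qed (use ball_norm_projector_le[OF P dual bound] in auto)

text \<open>A test function with values \<open>-1\<close> on \<open>J\<close> and \<open>1\<close>
  at the other nodes is sent to the affine function
  \<open>1 - 2 * sum c J - 2 * (sum l J \<bullet> y)\<close>, whose maximal modulus on the ball is
  the left-hand side.\<close>

lemma projector_norm_ge:
  fixes x :: "nat \<Rightarrow> real^'n"
  assumes P: "interpolation_projector x P"
    and dual: "dual_basis x l c"
    and J: "J \<subseteq> {1..CARD('n) + 1}"
  shows "\<bar>1 - 2 * sum c J\<bar> + 2 * norm (sum l J) \<le> projector_norm P"
proof -
  let ?I = "{1..CARD('n) + 1}"
  have adm: "admissible_nodes x" using P by (simp add: interpolation_projector_def)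
  have "(\<Sum>i\<in>?I. (0 \<bullet> x i + 1) *\<^sub>R l i) = 0" "(\<Sum>i\<in>?I. (0 \<bullet> x i + 1) * c i) = 1"
    by (rule barycentric_reproduces[OF adm dual])+
  then have sums: "sum l ?I = 0" "sum c ?I = 1" by simp_all
  define \<epsilon> :: "nat \<Rightarrow> real" where "\<epsilon> i = (if i \<in> J then -1 else 1)" for i
  have sum_\<epsilon>: "(\<Sum>i\<in>?I. \<epsilon> i * (l i \<bullet> y + c i)) = 1 - 2 * sum c J - 2 * (sum l J \<bullet> y)" for y
  proof -
    have "(\<Sum>i\<in>?I. \<epsilon> i * (l i \<bullet> y + c i)) = (\<Sum>i\<in>?I. (l i \<bullet> y + c i) - 2 * (if i \<in> J then l i \<bullet> y + c i else 0))"
      by (intro sum.cong) (auto simp: \<epsilon>_def)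
    also have "\<dots> = (sum l ?I \<bullet> y + sum c ?I) - 2 * (\<Sum>i\<in>?I. if i \<in> J then l i \<bullet> y + c i else 0)"
      unfolding sum_subtractf sum_distrib_left[symmetric] sum.distrib inner_sum_left ..
    also have "(\<Sum>i\<in>?I. if i \<in> J then l i \<bullet> y + c i else 0) = (\<Sum>i\<in>J. l i \<bullet> y + c i)"
      using J by (intro sum.mono_neutral_cong_right) auto
    finally show ?thesis unfolding sums by (simp add: sum.distrib inner_sum_left algebra_simps)
  qed
  \<comment> \<open>Clipping the affine interpolant of the signs keeps it continuous with norm at
    most \<open>1\<close> and does not change its values at the nodes.\<close>
  define f where "f y = max (-1) (min 1 (\<Sum>i\<in>?I. \<epsilon> i * (l i \<bullet> y + c i)))" for y
  have f: "f \<in> C_ball" unfolding f_def C_ball_def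
    by (auto intro!: continuous_intros)
  have f1: "ball_norm f \<le> 1" by (rule ball_norm_le) (auto simp: f_def)
  have fx: "f (x j) = \<epsilon> j" if j: "j \<in> ?I" for j
  proof -
    have "(\<Sum>i\<in>?I. \<epsilon> i * (l i \<bullet> x j + c i)) = (\<Sum>i\<in>?I. if i = j then \<epsilon> i else 0)"
      by (intro sum.cong refl) (use j in \<open>simp only: dual_basisD[OF dual], simp\<close>)
    then show ?thesis using j by (simp add: f_def \<epsilon>_def)
  qed
  have Pf: "P f y = 1 - 2 * sum c J - 2 * (sum l J \<bullet> y)" for y
  proof -
    have "P f y = (\<Sum>i\<in>?I. f (x i) * (l i \<bullet> y + c i))" by (rule projector_formula[OF P dual f])
    also have "\<dots> = (\<Sum>i\<in>?I. \<epsilon> i * (l i \<bullet> y + c i))" using fx by (intro sum.cong refl) simp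
    finally show ?thesis unfolding sum_\<epsilon> .
  qed
  \<comment> \<open>The sign makes both terms of \<open>P f y\<close> add up in modulus. If
    \<open>sum l J = 0\<close>, then \<open>sgn\<close> gives \<open>y = 0\<close>, which still lies
    in the ball.\<close>
  define \<sigma> :: real where "\<sigma> = (if 1 - 2 * sum c J \<ge> 0 then -1 else 1)"
  define y where "y = \<sigma> *\<^sub>R sgn (sum l J)"
  have "sum l J \<bullet> sgn (sum l J) = norm (sum l J)"
    by (cases "sum l J = 0") (simp_all add: sgn_div_norm power2_norm_eq_inner[symmetric] power2_eq_square)
  then have ly: "sum l J \<bullet> y = \<sigma> * norm (sum l J)" by (simp add: y_def)
  have y: "y \<in> cball 0 1" by (simp add: y_def \<sigma>_def norm_sgn)
  have "\<bar>1 - 2 * sum c J\<bar> + 2 * norm (sum l J) \<le> \<bar>P f y\<bar>"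
    unfolding Pf ly by (cases "1 - 2 * sum c J \<ge> 0") (simp_all add: \<sigma>_def abs_if)
  also have "\<dots> \<le> ball_norm (P f)"
  proof (rule abs_le_ball_norm[OF _ y])
    show "P f \<in> C_ball" using P f Pi1_subset_C_ball by (auto simp: interpolation_projector_def)
  qed
  also have "\<dots> \<le> projector_norm P"
    unfolding projector_norm_def
  proof (rule cSUP_upper)
    \<comment> \<open>A crude uniform bound, ensuring that the supremum defining
      \<open>projector_norm\<close> is over a set bounded above.\<close>
    have bnd: "(\<Sum>i\<in>?I. \<bar>l i \<bullet> z + c i\<bar>) \<le> (\<Sum>i\<in>?I. norm (l i) + \<bar>c i\<bar>)" if "norm z \<le> 1" for z
    proof (rule sum_mono)
      fix i
      have "\<bar>l i \<bullet> z\<bar> \<le> norm (l i) * norm z" by (rule Cauchy_Schwarz_ineq2)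
      also have "\<dots> \<le> norm (l i) * 1" using that by (intro mult_left_mono) auto
      finally show "\<bar>l i \<bullet> z + c i\<bar> \<le> norm (l i) + \<bar>c i\<bar>" by linarith
    qed
    show "bdd_above ((\<lambda>f. ball_norm (P f)) ` {f \<in> C_ball. ball_norm f \<le> 1})"
      by (rule bdd_aboveI2[where M = "\<Sum>i\<in>?I. norm (l i) + \<bar>c i\<bar>"])
         (use ball_norm_projector_le[OF P dual bnd] in auto)
  qed (use f f1 in auto)
  finally show ?thesis .
qed

lemma projector_barycentric:
  fixes x :: "nat \<Rightarrow> real^'n"
  assumes P: "interpolation_projector x P"
  obtains l c where "barycentric {1..CARD('n) + 1} CARD('n) x l c"
    and "\<And>J. J \<subseteq> {1..CARD('n) + 1} \<Longrightarrow> \<bar>1 - 2 * sum c J\<bar> + 2 * norm (sum l J) \<le> projector_norm P"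
proof -
  let ?I = "{1..CARD('n) + 1}"
  obtain l c where dual: "dual_basis x l c"
    using ex_dual_basis[OF P] by blast
  have adm: "admissible_nodes x" using P by (simp add: interpolation_projector_def)
  show thesis
  proof (rule that)
    show "barycentric ?I CARD('n) x l c"
    proof
      show "norm (x i) \<le> 1" if "i \<in> ?I" for i
        using adm that norm_node(1) by (auto simp: admissible_nodes_def)
      have "(\<Sum>i\<in>?I. (0 \<bullet> x i + 1) * c i) = 1"
        by (rule barycentric_reproduces(2)[OF adm dual])
      then show "sum c ?I = 1" by (simp)
    qed (use dual in \<open>auto simp: Suc_le_eq dual_basis_def\<close>)
  qed (rule projector_norm_ge[OF P dual])
qed

section \<open>The lower bound for projectors and its case of equality\<close>

lemma psi_max_le_projector_norm:
  fixes x :: "nat \<Rightarrow> real^'n"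
  assumes P: "interpolation_projector x P"
  shows "psi_max CARD('n) \<le> projector_norm P"
proof -
  obtain l c where b: "barycentric {1..CARD('n) + 1} CARD('n) x l c"
    and *: "\<And>J. J \<subseteq> {1..CARD('n) + 1} \<Longrightarrow> \<bar>1 - 2 * sum c J\<bar> + 2 * norm (sum l J) \<le> projector_norm P"
    using projector_barycentric[OF P] by blast
  have "CARD('n) \<ge> 1" by (simp add: Suc_le_eq)
  then obtain k where k: "1 \<le> k" "k \<le> CARD('n)" "psi_max CARD('n) = psi CARD('n) (real k)"
    by (rule psi_max_attained)
  show ?thesis unfolding k(3) by (rule barycentric.psi_le[OF b k(1,2) *])
qed

lemma dist_unit_vectors:
  fixes u v :: "'a::real_inner"
  assumes "norm u = 1" "norm v = 1"
  shows "dist u v = sqrt (2 - 2 * (u \<bullet> v))"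
  using assms unfolding dist_norm norm_eq_sqrt_inner
  by (simp add: inner_diff_left inner_diff_right inner_commute)

lemma projector_norm_eq_imp_regular:
  fixes x :: "nat \<Rightarrow> real^'n"
  assumes P: "interpolation_projector x P" and eq: "projector_norm P = psi_max CARD('n)"
  shows "regular_simplex_vertices (nodes x) \<and> nodes x \<subseteq> sphere 0 1"
proof -
  let ?I = "{1..CARD('n) + 1}"
  obtain l c where b: "barycentric ?I CARD('n) x l c"
    and *: "\<And>J. J \<subseteq> ?I \<Longrightarrow> \<bar>1 - 2 * sum c J\<bar> + 2 * norm (sum l J) \<le> projector_norm P"
    using projector_barycentric[OF P] by blast
  have "CARD('n) \<ge> 1" by (simp add: Suc_le_eq)
  then obtain k where k: "1 \<le> k" "k \<le> CARD('n)" "k \<le> CARD('n) - 1 \<or> CARD('n) = 1"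
    and psi: "psi_max CARD('n) = psi CARD('n) (real k)"
    by (rule psi_max_attained)
  have M: "projector_norm P = psi CARD('n) (real k)" using eq psi by simp
  have unit: "norm (x i) = 1" if "i \<in> ?I" for i
    by (rule barycentric.psi_eqD(2)[OF b k(1,2) * M that])
  have inner: "x i \<bullet> x j = - 1 / real CARD('n)" if "i \<in> ?I" "j \<in> ?I" "i \<noteq> j" for i j
    by (rule barycentric.psi_eq_imp_regular[OF b k(1,2) * M k(3) that])
  have "dist (x i) (x j) = sqrt (2 + 2 / real CARD('n))" if "i \<in> ?I" "j \<in> ?I" "i \<noteq> j" for i j
    unfolding dist_unit_vectors[OF unit[OF that(1)] unit[OF that(2)]] inner[OF that] by simp
  then have "\<exists>d. \<forall>u\<in>nodes x. \<forall>v\<in>nodes x. u \<noteq> v \<longrightarrow> dist u v = d"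
    unfolding nodes_def by (intro exI[of _ "sqrt (2 + 2 / real CARD('n))"]) blast
  then show ?thesis
    using P unit by (auto simp: regular_simplex_vertices_def interpolation_projector_def admissible_nodes_def nodes_def)
qed

section \<open>Inscribed regular simplices attain the bound\<close>

lemma regular_dual:
  assumes "n \<ge> 1" "norm (x i) = 1" "i \<noteq> j \<Longrightarrow> x i \<bullet> x j = - 1 / real n"
  shows "(real n / (real n + 1)) *\<^sub>R x i \<bullet> x j + 1 / (real n + 1) = (if i = j then 1 else 0)"
proof (cases "i = j")
  case True
  have "x i \<bullet> x i = 1" using assms(2) by (simp add: power2_norm_eq_inner[symmetric])
  then show ?thesis using True by (simp add: add_divide_distrib[symmetric])
next
  case False
  then show ?thesis using assms(1,3) by simp
qed

text \<open>Equal distances between unit vectors give one common product \<open>m\<close>. That the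
  centroid is the origin is not assumed; \<open>m\<close> is found from the reproduction of the
  linear forms \<open>x j \<bullet> y\<close>.\<close>

lemma regular_inscribed_inner:
  fixes x :: "nat \<Rightarrow> real^'n"
  assumes P: "interpolation_projector x P"
    and reg: "regular_simplex_vertices (nodes x)" and sphere: "nodes x \<subseteq> sphere 0 1"
    and ij: "i \<in> {1..CARD('n) + 1}" "j \<in> {1..CARD('n) + 1}" "i \<noteq> j"
  shows "x i \<bullet> x j = - 1 / real CARD('n)"
proof -
  let ?I = "{1..CARD('n) + 1}"
  obtain l c where dual: "dual_basis x l c"
    using ex_dual_basis[OF P] by blast
  have adm: "admissible_nodes x" using P by (simp add: interpolation_projector_def)
  obtain d where d: "\<And>u v. u \<in> nodes x \<Longrightarrow> v \<in> nodes x \<Longrightarrow> u \<noteq> v \<Longrightarrow> dist u v = d"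
    using reg by (auto simp: regular_simplex_vertices_def)
  have unit: "x i \<bullet> x i = 1" if "i \<in> ?I" for i
    using norm_node(2)[OF that sphere] by (simp add: power2_norm_eq_inner[symmetric])
  define m where "m = 1 - d\<^sup>2 / 2"
  have inner: "x i \<bullet> x j = m" if "i \<in> ?I" "j \<in> ?I" "i \<noteq> j" for i j
  proof -
    have "x i \<noteq> x j" using inj_on_nodes[OF adm] that by (auto dest: inj_onD)
    then have "dist (x i) (x j) = d" using that by (intro d) (auto simp: nodes_def)
    then have "d = sqrt (2 - 2 * (x i \<bullet> x j))"
      using dist_unit_vectors[of "x i" "x j"] norm_node(2)[OF _ sphere] that by simp
    moreover have "x i \<bullet> x j \<le> norm (x i) * norm (x j)" by (rule norm_cauchy_schwarz)
    then have "x i \<bullet> x j \<le> 1" using norm_node(2)[OF _ sphere] that by simp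
    ultimately show ?thesis by (simp add: m_def diff_divide_distrib)
  qed
  have "(\<Sum>i\<in>?I. (0 \<bullet> x i + 1) * c i) = 1"
    by (rule barycentric_reproduces(2)[OF adm dual])
  then have sum_c: "sum c ?I = 1" by (simp)
  \<comment> \<open>Reproducing \<open>x j \<bullet> y\<close> at the origin gives
    \<open>m + (1 - m) * c j = 0\<close>. Summing over \<open>j\<close> with
    \<open>sum c = 1\<close> then yields \<open>1 - m = - m * (n + 1)\<close>.\<close>
  have cj: "c j * (1 - m) = - m" if j: "j \<in> ?I" for j
  proof -
    have "(\<Sum>i\<in>?I. (x j \<bullet> x i + 0) * c i) = 0"
      by (rule barycentric_reproduces(2)[OF adm dual])
    moreover have "(\<Sum>i\<in>?I. (x j \<bullet> x i + 0) * c i) = (\<Sum>i\<in>?I. m * c i + (if i = j then (1 - m) * c i else 0))"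
      by (intro sum.cong refl) (use unit inner j in \<open>auto simp: algebra_simps\<close>)
    moreover have "\<dots> = m + (1 - m) * c j"
      unfolding sum.distrib sum_distrib_left[symmetric] sum_c using j by simp
    ultimately show ?thesis by (simp add: algebra_simps)
  qed
  have "1 - m = (\<Sum>j\<in>?I. c j * (1 - m))"
    unfolding sum_distrib_right[symmetric] sum_c by simp
  also have "\<dots> = (\<Sum>j\<in>?I. - m)" by (rule sum.cong[OF refl cj])
  also have "\<dots> = - m * (real CARD('n) + 1)" by simp
  finally have "m = - 1 / real CARD('n)" by (simp add: field_simps)
  then show ?thesis using inner[OF ij] by simp
qed

lemma regular_imp_projector_norm_le:
  fixes x :: "nat \<Rightarrow> real^'n"
  assumes P: "interpolation_projector x P"
    and reg: "regular_simplex_vertices (nodes x)" "nodes x \<subseteq> sphere 0 1"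
  shows "projector_norm P \<le> psi_max CARD('n)"
proof (rule projector_norm_le[OF P])
  let ?I = "{1..CARD('n) + 1}"
  have n: "CARD('n) \<ge> 1" by (simp add: Suc_le_eq)
  have unit: "\<And>i. i \<in> ?I \<Longrightarrow> norm (x i) = 1" using reg(2) by (rule norm_node(2)[rotated])
  note inner = regular_inscribed_inner[OF P reg]
  show "dual_basis x (\<lambda>i. (real CARD('n) / (real CARD('n) + 1)) *\<^sub>R x i) (\<lambda>i. 1 / (real CARD('n) + 1))"
    unfolding dual_basis_def by (intro ballI regular_dual[where x = x, OF n unit inner])
  show "(\<Sum>i\<in>?I. \<bar>(real CARD('n) / (real CARD('n) + 1)) *\<^sub>R x i \<bullet> y + 1 / (real CARD('n) + 1)\<bar>) \<le> psi_max CARD('n)"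
    if "norm y \<le> 1" for y
    by (rule lebesgue_function_regular_le[OF _ _ n unit inner that]) auto
qed

section \<open>Existence of an inscribed regular simplex\<close>

lemma ex_regular_family:
  obtains x :: "nat \<Rightarrow> real^'n"
  where "\<And>i. i \<in> {1..CARD('n) + 1} \<Longrightarrow> norm (x i) = 1"
    and "\<And>i j. i \<in> {1..CARD('n) + 1} \<Longrightarrow> j \<in> {1..CARD('n) + 1} \<Longrightarrow> i \<noteq> j \<Longrightarrow>
           x i \<bullet> x j = - 1 / real CARD('n)"
proof -
  define n where "n = CARD('n)"
  have n: "real n > 0" by (simp add: n_def)
  obtain e :: "nat \<Rightarrow> 'n" where e: "bij_betw e {1..n} UNIV"
    using ex_bij_betw_nat_finite_1[of "UNIV :: 'n set"] by (auto simp: n_def)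
  \<comment> \<open>The last vertex is \<open>one\<close> normalised and negated. The square of
    \<open>\<alpha>\<close> is the gap \<open>1 + 1 / n\<close> between diagonal and off-diagonal
    products, and \<open>\<beta>\<close> is chosen so that
    \<open>\<alpha> + n * \<beta> = \<gamma>\<close>, which gives the products with the last
    vertex.\<close>
  define \<gamma> \<alpha> \<beta> where "\<gamma> = 1 / sqrt (real n)" and "\<alpha> = sqrt (1 + 1 / real n)" and "\<beta> = (\<gamma> - \<alpha>) / real n"
  define one :: "real^'n" where "one = (\<chi> i. 1)"
  define x where "x i = (if i \<le> n then \<alpha> *\<^sub>R axis (e i) 1 + \<beta> *\<^sub>R one else (- \<gamma>) *\<^sub>R one)" for i
  have one: "one \<bullet> one = real n" "axis k 1 \<bullet> one = 1" "one \<bullet> axis k 1 = 1" for k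
    by (simp_all add: one_def inner_vec_def n_def axis_def inner_axis)
  have sq: "\<gamma> * \<gamma> = 1 / real n" "\<alpha> * \<alpha> = 1 + 1 / real n"
    using n by (auto simp: \<gamma>_def \<alpha>_def)
  have n\<beta>: "real n * \<beta> = \<gamma> - \<alpha>" using n by (simp add: \<beta>_def)
  have \<beta>: "2 * \<alpha> * \<beta> + \<beta> * \<beta> * real n = - 1 / real n"
  proof -
    have "2 * \<alpha> * \<beta> + \<beta> * \<beta> * real n = \<beta> * (2 * \<alpha> + real n * \<beta>)" by (simp add: algebra_simps)
    also have "\<dots> = (\<gamma> * \<gamma> - \<alpha> * \<alpha>) / real n" unfolding n\<beta> by (simp add: \<beta>_def algebra_simps)
    finally show ?thesis unfolding sq by simp
  qed
  have ax: "axis (e i) 1 \<bullet> axis (e j) (1 :: real) = (if i = j then 1 else 0)" if "i \<in> {1..n}" "j \<in> {1..n}" for i j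
    using e that by (auto simp: inner_axis_axis bij_betw_def dest: inj_onD)
  have small: "x i \<bullet> x j = (if i = j then 1 else - 1 / real n)" if "i \<in> {1..n}" "j \<in> {1..n}" for i j
  proof -
    have "x i \<bullet> x j = \<alpha> * \<alpha> * (axis (e i) 1 \<bullet> axis (e j) (1 :: real)) + (2 * \<alpha> * \<beta> + \<beta> * \<beta> * real n)"
      using that by (simp add: x_def inner_add_left inner_add_right one algebra_simps)
    then show ?thesis unfolding \<beta> sq ax[OF that] by simp
  qed
  have mixed: "x i \<bullet> x (n + 1) = - 1 / real n" if "i \<in> {1..n}" for i
  proof -
    have "x i \<bullet> x (n + 1) = - \<gamma> * (\<alpha> + real n * \<beta>)"
      using that by (simp add: x_def inner_add_left one algebra_simps)
    then show ?thesis unfolding n\<beta> using sq by simp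
  qed
  have last: "x (n + 1) \<bullet> x (n + 1) = 1"
    using sq n by (simp add: x_def one mult.assoc[symmetric])
  have all: "x i \<bullet> x j = (if i = j then 1 else - 1 / real n)" if "i \<in> {1..n + 1}" "j \<in> {1..n + 1}" for i j
  proof -
    consider "i \<in> {1..n}" "j \<in> {1..n}" | "i \<in> {1..n}" "j = n + 1" | "i = n + 1" "j \<in> {1..n}" | "i = n + 1" "j = n + 1"
      using \<open>i \<in> {1..n + 1}\<close> \<open>j \<in> {1..n + 1}\<close> by force
    then show ?thesis
    proof cases
      case 1 then show ?thesis by (rule small)
    next
      case 2 then show ?thesis using mixed by simp
    next
      case 3 then show ?thesis using mixed by (simp add: inner_commute)
    next
      case 4 then show ?thesis using last by simp
    qed
  qed
  show thesis
    by (rule that[of x]) (use all in \<open>auto simp: n_def norm_eq_1\<close>)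
qed

lemma ex_regular_projector:
  "\<exists>(x :: nat \<Rightarrow> real^'n) P. interpolation_projector x P \<and>
     regular_simplex_vertices (nodes x) \<and> nodes x \<subseteq> sphere 0 1"
proof -
  define n where "n = CARD('n)"
  have n: "n \<ge> 1" by (simp add: n_def Suc_le_eq)
  let ?I = "{1..n + 1}"
  obtain x :: "nat \<Rightarrow> real^'n" where unit: "\<And>i. i \<in> ?I \<Longrightarrow> norm (x i) = 1"
    and inner: "\<And>i j. i \<in> ?I \<Longrightarrow> j \<in> ?I \<Longrightarrow> i \<noteq> j \<Longrightarrow> x i \<bullet> x j = - 1 / real n"
    using ex_regular_family unfolding n_def by blast
  define L where "L i y = (real n / (real n + 1)) *\<^sub>R x i \<bullet> y + 1 / (real n + 1)" for i y
  have L: "L i (x j) = (if i = j then 1 else 0)" if "i \<in> ?I" "j \<in> ?I" for i j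
    unfolding L_def by (rule regular_dual[where x = x, OF n unit[OF that(1)] inner[OF that]])
  have inj: "inj_on x ?I"
  proof (rule inj_onI)
    fix i j assume "i \<in> ?I" "j \<in> ?I" "x i = x j"
    then show "i = j" using L[of i j] L[of i i] by (auto split: if_splits)
  qed
  have indep: "\<not> affine_dependent (nodes x)"
  proof
    assume "affine_dependent (nodes x)"
    then obtain U v where U: "sum U (x ` ?I) = 0" "v \<in> x ` ?I" "U v \<noteq> 0" "(\<Sum>w\<in>x ` ?I. U w *\<^sub>R w) = 0"
      unfolding nodes_def n_def[symmetric] by (subst (asm) affine_dependent_explicit_finite) auto
    then obtain j where j: "j \<in> ?I" "v = x j" by auto
    \<comment> \<open>Applying the coordinate form \<open>L j\<close> to the affine dependence
      isolates the coefficient at \<open>x j\<close>, which was supposed to be non-zero.\<close>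
    have "0 = (real n / (real n + 1)) *\<^sub>R x j \<bullet> (\<Sum>w\<in>x ` ?I. U w *\<^sub>R w) + 1 / (real n + 1) * sum U (x ` ?I)"
      unfolding U by simp
    also have "\<dots> = (\<Sum>w\<in>x ` ?I. U w * L j w)"
      unfolding L_def inner_sum_right sum_distrib_left sum.distrib[symmetric]
      by (intro sum.cong refl) (simp add: algebra_simps)
    also have "\<dots> = (\<Sum>i\<in>?I. U (x i) * L j (x i))"
      by (rule sum.reindex[OF inj, unfolded o_def])
    also have "\<dots> = (\<Sum>i\<in>?I. if i = j then U (x i) else 0)"
      using L j by (intro sum.cong refl) auto
    also have "\<dots> = U v" using j by simp
    finally show False using U by simp
  qed
  have nondeg: "nondegenerate_simplex_vertices (nodes x)"
    using indep card_image[OF inj] by (simp add: nondegenerate_simplex_vertices_def nodes_def n_def)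
  have sphere: "nodes x \<subseteq> sphere 0 1" using unit by (auto simp: nodes_def n_def)
  have "dist (x i) (x j) = sqrt (2 + 2 / real n)" if "i \<in> ?I" "j \<in> ?I" "i \<noteq> j" for i j
    unfolding dist_unit_vectors[OF unit[OF that(1)] unit[OF that(2)]] inner[OF that] by simp
  then have "\<exists>d. \<forall>u\<in>nodes x. \<forall>v\<in>nodes x. u \<noteq> v \<longrightarrow> dist u v = d"
    unfolding nodes_def n_def[symmetric] by (intro exI[of _ "sqrt (2 + 2 / real n)"]) blast
  then have reg: "regular_simplex_vertices (nodes x)"
    using nondeg by (simp add: regular_simplex_vertices_def)
  define P where "P f y = (\<Sum>i\<in>?I. f (x i) * L i y)" for f :: "real^'n \<Rightarrow> real" and y
  have "interpolation_projector x P"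
    unfolding interpolation_projector_def
  proof (intro conjI ballI)
    show "admissible_nodes x" using nondeg sphere by (auto simp: admissible_nodes_def)
    show "linear_on_C_ball P"
      unfolding linear_on_C_ball_def P_def
      by (simp add: sum.distrib sum_distrib_left distrib_right mult.assoc)
    fix f :: "real^'n \<Rightarrow> real"
    have "P f = (\<lambda>y. (\<Sum>i\<in>?I. (f (x i) * (real n / (real n + 1))) *\<^sub>R x i) \<bullet> y + (\<Sum>i\<in>?I. f (x i) / (real n + 1)))"
      unfolding P_def L_def inner_sum_left sum.distrib[symmetric]
      by (simp add: distrib_left mult.assoc)
    then show "P f \<in> Pi1" unfolding Pi1_def by blast
    fix j assume "j \<in> {1..CARD('n) + 1}"
    then have j: "j \<in> ?I" by (simp add: n_def)
    have "P f (x j) = (\<Sum>i\<in>?I. if i = j then f (x i) else 0)"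
      unfolding P_def using L j by (intro sum.cong refl) auto
    then show "P f (x j) = f (x j)" using j by simp
  qed
  then show ?thesis using reg sphere by blast
qed

theorem theorem2:
  "theta TYPE('n::finite) =
     max (psi CARD('n) (real_of_int (a_opt CARD('n))))
         (psi CARD('n) (real_of_int (a_opt CARD('n) + 1))) \<and>
   (\<forall>(x :: nat \<Rightarrow> real^'n) P. interpolation_projector x P \<longrightarrow>
      (projector_norm P = theta TYPE('n) \<longleftrightarrow>
        regular_simplex_vertices (nodes x) \<and> nodes x \<subseteq> sphere 0 1))"
proof -
  have norm_eq: "projector_norm P = psi_max CARD('n) \<longleftrightarrow>
      regular_simplex_vertices (nodes x) \<and> nodes x \<subseteq> sphere 0 1"
    if "interpolation_projector x P" for x :: "nat \<Rightarrow> real^'n" and P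
    using projector_norm_eq_imp_regular[OF that] regular_imp_projector_norm_le[OF that]
      psi_max_le_projector_norm[OF that] by (auto intro: antisym)
  \<comment> \<open>The regular simplex attains the lower bound, so the \<open>LEAST\<close> in
    \<open>theta\<close> is a genuine minimum.\<close>
  have "theta TYPE('n) = psi_max CARD('n)"
    unfolding theta_def
  proof (rule Least_equality)
    show "\<exists>(x :: nat \<Rightarrow> real^'n) P. interpolation_projector x P \<and> psi_max CARD('n) = projector_norm P"
      using ex_regular_projector[where 'n = 'n] norm_eq by metis
  qed (use psi_max_le_projector_norm in auto)
  with norm_eq show ?thesis by (simp add: psi_max_def)
qed

end
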